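(* There is a simple connected bridgeless cubic graph $G$, with vertices labeled by $0,1,\ldots,111$, such that $$|V(G)|=112,\qquad |E(G)|=168,$$ and $G$ has no Petersen coloring and no normal 5-edge-coloring. Moreover, $G$ has girth five, edge-connectivity three, and vertex-connectivity three. The SHA-256 digest of the normalized sorted edge list of $G$ is dc16cc18600cf77c8661b7baf89c7019f265299308541961ff884ea7187b4e8b (hexadecimal).
   Context: **Colorings.** For cubic graphs $G$ and $H$, an $H$-coloring of $G$ is a map $\varphi:E(G)\to E(H)$ such that at every vertex of $G$ the three incident edges are mapped bijectively onto the three edges incident with some vertex of $H$. A Petersen coloring is an $H$-coloring with $H$ the Petersen graph, realized as the Kneser graph $KG(5,2)$: its vertices are the 2-element subsets of $\{0,1,2,3,4\}$, two being adjacent when disjoint. A proper 5-edge-coloring of a cubic graph is normal if for every edge $uv$, the set of colors appearing on the edges incident with $u$ or with $v$ (including $uv$ itself) has exactly three elements (the edge is poor) or exactly five elements (the edge is rich). **Normalized sorted edge list.** For a graph with integer vertex labels, this is the ASCII JSON array in which every edge is written as $[u,v]$ with $u<v$, the pairs are sorted lexicographically (as integer pairs), the separators are a comma and a colon (so items are separated by "," alone), and no optional whitespace is used. The digest is the SHA-256 hash of this byte string, and it identifies that exact labeled edge set. **The explicit labeled graph.** The digest in the claim identifies the following labeled graph with vertex set $\{0,\ldots,111\}$ and 168 edges. The notation "$u: v_1,v_2,\ldots$" lists all edges $\{u,v_i\}$ with $u<v_i$; vertices not shown before a colon have no larger neighbor. 0: 1,5,31; 1: 2,6; 2: 7,100;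 3: 5,6,11; 4: 6,7,9; 5: 7; 8: 9,10,11; 9: 14; 10: 12,20; 11: 28; 12: 13,17; 13: 14,18; 14: 19; 15: 17,18,22; 16: 18,19,56; 17: 19; 20: 21,25; 21: 22,26; 22: 27; 23: 25,26,30; 24: 26,27,39; 25: 27; 28: 29,33; 29: 30,34; 30: 35; 31: 33,34; 32: 34,35,37; 33: 35; 36: 37,38,39; 37: 42; 38: 64,92; 39: 78; 40: 41,45,71; 41: 42,46; 42: 47; 43: 45,46,51; 44: 46,47,49; 45: 47; 48: 49,50,51; 49: 54; 50: 52,60; 51: 68; 52: 53,57; 53: 54,58; 54: 59; 55: 57,58,62; 56: 58,59; 57: 59; 60: 61,65; 61: 62,66; 62: 67; 63: 65,66,70; 64: 66,67; 65: 67; 68: 69,73; 69: 70,74; 70: 75; 71: 73,74; 72: 74,75,108; 73: 75; 76: 77,81,107; 77: 78,82; 78: 83; 79: 81,82,87; 80: 82,83,85; 81: 83; 84: 85,86,87; 85: 90; 86: 88,96; 87: 104; 88: 89,93; 89: 90,94; 90: 95; 91: 93,94,98; 92: 94,95; 93: 95; 96: 97,101; 97: 98,102; 98: 103; 99: 101,102,106; 100: 102,103; 101: 103; 104: 105,109; 105: 106,110; 106: 111; 107: 109,110; 108: 110,111; 109: 111. *)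

theory Defs
  imports
    "HOL-Library.Word"
    "HOL-Library.Extended_Nat"
    "HOL-Library.Product_Lexorder"
begin

section \<open>Simple graphs\<close>

datatype 'a graph = Graph (verts: "'a set") (edges: "'a set set")

definition simple_graph :: "'a graph \<Rightarrow> bool" where
  "simple_graph G \<longleftrightarrow> finite (verts G) \<and> (\<forall>e\<in>edges G. e \<subseteq> verts G \<and> card e = 2)"

definition incident :: "'a graph \<Rightarrow> 'a \<Rightarrow> 'a set set" where
  "incident G v = {e \<in> edges G. v \<in> e}"

definition cubic :: "'a graph \<Rightarrow> bool" where
  "cubic G \<longleftrightarrow> (\<forall>v\<in>verts G. card (incident G v) = 3)"

definition delete_verts :: "'a graph \<Rightarrow> 'a set \<Rightarrow> 'a graph" where
  "delete_verts G X = Graph (verts G - X) {e \<in> edges G. e \<inter> X = {}}"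

definition delete_edges :: "'a graph \<Rightarrow> 'a set set \<Rightarrow> 'a graph" where
  "delete_edges G F = Graph (verts G) (edges G - F)"

definition reachable :: "'a graph \<Rightarrow> ('a \<times> 'a) set" where
  "reachable G = {(u, v). u \<in> verts G \<and> v \<in> verts G \<and> (u, v) \<in> {(x, y). {x, y} \<in> edges G}\<^sup>*}"

definition components :: "'a graph \<Rightarrow> 'a set set" where
  "components G = verts G // reachable G"

definition connected_graph :: "'a graph \<Rightarrow> bool" where
  "connected_graph G \<longleftrightarrow>
     verts G \<noteq> {} \<and> (\<forall>u\<in>verts G. \<forall>v\<in>verts G. (u, v) \<in> reachable G)"

definition is_bridge :: "'a graph \<Rightarrow> 'a set \<Rightarrow> bool" where
  "is_bridge G e \<longleftrightarrow>
     e \<in> edges G \<and> card (components (delete_edges G {e})) > card (components G)"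

definition bridgeless :: "'a graph \<Rightarrow> bool" where
  "bridgeless G \<longleftrightarrow> \<not> (\<exists>e. is_bridge G e)"

text \<open>A cycle is given by the list of its vertices, the first one not being repeated at the end.\<close>

definition is_cycle :: "'a graph \<Rightarrow> 'a list \<Rightarrow> bool" where
  "is_cycle G c \<longleftrightarrow> 3 \<le> length c \<and> distinct c \<and> set c \<subseteq> verts G \<and>
     (\<forall>i<length c. {c ! i, c ! (Suc i mod length c)} \<in> edges G)"

definition girth :: "'a graph \<Rightarrow> enat" where
  "girth G = (INF c \<in> {c. is_cycle G c}. enat (length c))"

definition edge_connected :: "nat \<Rightarrow> 'a graph \<Rightarrow> bool" where
  "edge_connected k G \<longleftrightarrow> card (verts G) > 1 \<and>
     (\<forall>F\<subseteq>edges G. card F < k \<longrightarrow> connected_graph (delete_edges G F))"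

definition vertex_connected :: "nat \<Rightarrow> 'a graph \<Rightarrow> bool" where
  "vertex_connected k G \<longleftrightarrow> card (verts G) > k \<and>
     (\<forall>X\<subseteq>verts G. card X < k \<longrightarrow> connected_graph (delete_verts G X))"

text \<open>For a finite simple graph both suprema range over finite sets of naturals, so they are
  maxima, or 0 if the set is empty.\<close>

definition edge_connectivity :: "'a graph \<Rightarrow> nat" where
  "edge_connectivity G = Sup {k. edge_connected k G}"

definition vertex_connectivity :: "'a graph \<Rightarrow> nat" where
  "vertex_connectivity G = Sup {k. vertex_connected k G}"

section \<open>Colorings\<close>

definition is_H_coloring :: "'b graph \<Rightarrow> 'a graph \<Rightarrow> ('a set \<Rightarrow> 'b set) \<Rightarrow> bool" where
  "is_H_coloring H G \<phi> \<longleftrightarrow> \<phi> ` edges G \<subseteq> edges H \<and>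
     (\<forall>v\<in>verts G. \<exists>w\<in>verts H. bij_betw \<phi> (incident G v) (incident H w))"

definition petersen :: "nat set graph" where
  "petersen = (let V = {s. s \<subseteq> {0, 1, 2, 3, 4} \<and> card s = 2}
     in Graph V {{s, t} | s t. s \<in> V \<and> t \<in> V \<and> s \<inter> t = {}})"

definition has_petersen_coloring :: "'a graph \<Rightarrow> bool" where
  "has_petersen_coloring G \<longleftrightarrow> (\<exists>\<phi>. is_H_coloring petersen G \<phi>)"

definition proper_edge_coloring :: "nat \<Rightarrow> 'a graph \<Rightarrow> ('a set \<Rightarrow> nat) \<Rightarrow> bool" where
  "proper_edge_coloring k G c \<longleftrightarrow> (\<forall>e\<in>edges G. c e < k) \<and>
     (\<forall>e\<in>edges G. \<forall>f\<in>edges G. e \<noteq> f \<and> e \<inter> f \<noteq> {} \<longrightarrow> c e \<noteq> c f)"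

definition colors_around :: "'a graph \<Rightarrow> ('a set \<Rightarrow> nat) \<Rightarrow> 'a set \<Rightarrow> nat set" where
  "colors_around G c e = c ` (\<Union>v\<in>e. incident G v)"

definition poor :: "'a graph \<Rightarrow> ('a set \<Rightarrow> nat) \<Rightarrow> 'a set \<Rightarrow> bool" where
  "poor G c e \<longleftrightarrow> card (colors_around G c e) = 3"

definition rich :: "'a graph \<Rightarrow> ('a set \<Rightarrow> nat) \<Rightarrow> 'a set \<Rightarrow> bool" where
  "rich G c e \<longleftrightarrow> card (colors_around G c e) = 5"

definition normal_5_edge_coloring :: "'a graph \<Rightarrow> ('a set \<Rightarrow> nat) \<Rightarrow> bool" where
  "normal_5_edge_coloring G c \<longleftrightarrow>
     proper_edge_coloring 5 G c \<and> (\<forall>e\<in>edges G. poor G c e \<or> rich G c e)"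

definition has_normal_5_edge_coloring :: "'a graph \<Rightarrow> bool" where
  "has_normal_5_edge_coloring G \<longleftrightarrow> (\<exists>c. normal_5_edge_coloring G c)"

section \<open>SHA-256 (FIPS 180-4)\<close>

type_synonym byte = "8 word"
type_synonym word32 = "32 word"

definition sha_ch :: "word32 \<Rightarrow> word32 \<Rightarrow> word32 \<Rightarrow> word32" where
  "sha_ch x y z = xor (and x y) (and (not x) z)"

definition sha_maj :: "word32 \<Rightarrow> word32 \<Rightarrow> word32 \<Rightarrow> word32" where
  "sha_maj x y z = xor (xor (and x y) (and x z)) (and y z)"

definition sha_Sigma0 :: "word32 \<Rightarrow> word32" where
  "sha_Sigma0 x = xor (xor (word_rotr 2 x) (word_rotr 13 x)) (word_rotr 22 x)"

definition sha_Sigma1 :: "word32 \<Rightarrow> word32" where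
  "sha_Sigma1 x = xor (xor (word_rotr 6 x) (word_rotr 11 x)) (word_rotr 25 x)"

definition sha_sigma0 :: "word32 \<Rightarrow> word32" where
  "sha_sigma0 x = xor (xor (word_rotr 7 x) (word_rotr 18 x)) (drop_bit 3 x)"

definition sha_sigma1 :: "word32 \<Rightarrow> word32" where
  "sha_sigma1 x = xor (xor (word_rotr 17 x) (word_rotr 19 x)) (drop_bit 10 x)"

definition sha_K :: "word32 list" where
  "sha_K =
    [0x428a2f98, 0x71374491, 0xb5c0fbcf, 0xe9b5dba5, 0x3956c25b, 0x59f111f1,
     0x923f82a4, 0xab1c5ed5, 0xd807aa98, 0x12835b01, 0x243185be, 0x550c7dc3,
     0x72be5d74, 0x80deb1fe, 0x9bdc06a7, 0xc19bf174, 0xe49b69c1, 0xefbe4786,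
     0x0fc19dc6, 0x240ca1cc, 0x2de92c6f, 0x4a7484aa, 0x5cb0a9dc, 0x76f988da,
     0x983e5152, 0xa831c66d, 0xb00327c8, 0xbf597fc7, 0xc6e00bf3, 0xd5a79147,
     0x06ca6351, 0x14292967, 0x27b70a85, 0x2e1b2138, 0x4d2c6dfc, 0x53380d13,
     0x650a7354, 0x766a0abb, 0x81c2c92e, 0x92722c85, 0xa2bfe8a1, 0xa81a664b,
     0xc24b8b70, 0xc76c51a3, 0xd192e819, 0xd6990624, 0xf40e3585, 0x106aa070,
     0x19a4c116, 0x1e376c08, 0x2748774c, 0x34b0bcb5, 0x391c0cb3, 0x4ed8aa4a,
     0x5b9cca4f, 0x682e6ff3, 0x748f82ee, 0x78a5636f, 0x84c87814, 0x8cc70208,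
     0x90befffa, 0xa4506ceb, 0xbef9a3f7, 0xc67178f2]"

definition sha_H0 :: "word32 list" where
  "sha_H0 =
    [0x6a09e667, 0xbb67ae85, 0x3c6ef372, 0xa54ff53a,
     0x510e527f, 0x9b05688c, 0x1f83d9ab, 0x5be0cd19]"

definition big_endian_bytes :: "'a::len word \<Rightarrow> byte list" where
  "big_endian_bytes w = map (\<lambda>i. ucast (drop_bit (8 * i) w)) (rev [0..<LENGTH('a) div 8])"

text \<open>The message is padded to a multiple of 64 bytes with the byte 0x80, the least possible
  number of zero bytes, and the message length in bits as a 64-bit big-endian integer.\<close>

definition sha_pad :: "byte list \<Rightarrow> byte list" where
  "sha_pad m = m @ [0x80] @ replicate (nat ((55 - int (length m)) mod 64)) 0 @
     big_endian_bytes (of_nat (8 * length m) :: 64 word)"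

fun chunks :: "nat \<Rightarrow> 'a list \<Rightarrow> 'a list list" where
  "chunks n xs = (if n = 0 \<or> xs = [] then [] else take n xs # chunks n (drop n xs))"

declare chunks.simps [simp del]

definition sha_blocks :: "byte list \<Rightarrow> word32 list list" where
  "sha_blocks m = chunks 16 (map word_rcat (chunks 4 (sha_pad m)))"

text \<open>Appends the word W(t) of the message schedule, where t is the current length.\<close>

definition sha_extend :: "word32 list \<Rightarrow> word32 list" where
  "sha_extend W = (let t = length W in
     W @ [sha_sigma1 (W ! (t - 2)) + W ! (t - 7) + sha_sigma0 (W ! (t - 15)) + W ! (t - 16)])"

definition sha_schedule :: "word32 list \<Rightarrow> word32 list" where
  "sha_schedule B = (sha_extend ^^ 48) B"

fun sha_round :: "word32 \<times> word32 \<Rightarrow> word32 list \<Rightarrow> word32 list" where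
  "sha_round (k, w) [a, b, c, d, e, f, g, h] =
     (let T1 = h + sha_Sigma1 e + sha_ch e f g + k + w;
          T2 = sha_Sigma0 a + sha_maj a b c
      in [T1 + T2, a, b, c, d + T1, e, f, g])"
| "sha_round _ s = s"

definition sha_compress :: "word32 list \<Rightarrow> word32 list \<Rightarrow> word32 list" where
  "sha_compress B H = map2 (+) H (fold sha_round (zip sha_K (sha_schedule B)) H)"

definition sha256 :: "byte list \<Rightarrow> byte list" where
  "sha256 m = concat (map big_endian_bytes (fold sha_compress (sha_blocks m) sha_H0))"

definition hex_of_bytes :: "byte list \<Rightarrow> string" where
  "hex_of_bytes bs = concat (map (\<lambda>b. [''0123456789abcdef'' ! (unat b div 16),
                                       ''0123456789abcdef'' ! (unat b mod 16)]) bs)"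

section \<open>Normalized sorted edge list\<close>

fun decimal :: "nat \<Rightarrow> string" where
  "decimal n = (if n < 10 then [] else decimal (n div 10)) @ [''0123456789'' ! (n mod 10)]"

declare decimal.simps [simp del]

fun comma_separated :: "string list \<Rightarrow> string" where
  "comma_separated [] = []"
| "comma_separated [s] = s"
| "comma_separated (s # t # ss) = s @ '','' @ comma_separated (t # ss)"

definition json_array :: "string list \<Rightarrow> string" where
  "json_array ss = ''['' @ comma_separated ss @ '']''"

text \<open>The order on pairs used by the sorting function is the lexicographic one, from
  \<^theory>\<open>HOL-Library.Product_Lexorder\<close>.\<close>

definition sorted_edge_pairs :: "nat graph \<Rightarrow> (nat \<times> nat) list" where
  "sorted_edge_pairs G = sorted_list_of_set {(u, v). u < v \<and> {u, v} \<in> edges G}"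

definition normalized_edge_list :: "nat graph \<Rightarrow> string" where
  "normalized_edge_list G =
     json_array (map (\<lambda>(u, v). json_array [decimal u, decimal v]) (sorted_edge_pairs G))"

definition ascii_bytes :: "string \<Rightarrow> byte list" where
  "ascii_bytes = map of_char"

definition edge_list_digest :: "nat graph \<Rightarrow> string" where
  "edge_list_digest G = hex_of_bytes (sha256 (ascii_bytes (normalized_edge_list G)))"

section \<open>The edge set identified by the digest\<close>

definition larger_neighbors :: "(nat \<times> nat list) list" where
  "larger_neighbors =
    [(0, [1,5,31]), (1, [2,6]), (2, [7,100]), (3, [5,6,11]), (4, [6,7,9]),
     (5, [7]), (8, [9,10,11]), (9, [14]), (10, [12,20]), (11, [28]),
     (12, [13,17]), (13, [14,18]), (14, [19]), (15, [17,18,22]), (16, [18,19,56]),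
     (17, [19]), (20, [21,25]), (21, [22,26]), (22, [27]), (23, [25,26,30]),
     (24, [26,27,39]), (25, [27]), (28, [29,33]), (29, [30,34]), (30, [35]),
     (31, [33,34]), (32, [34,35,37]), (33, [35]), (36, [37,38,39]), (37, [42]),
     (38, [64,92]), (39, [78]), (40, [41,45,71]), (41, [42,46]), (42, [47]),
     (43, [45,46,51]), (44, [46,47,49]), (45, [47]), (48, [49,50,51]), (49, [54]),
     (50, [52,60]), (51, [68]), (52, [53,57]), (53, [54,58]), (54, [59]),
     (55, [57,58,62]), (56, [58,59]), (57, [59]), (60, [61,65]), (61, [62,66]),
     (62, [67]), (63, [65,66,70]), (64, [66,67]), (65, [67]), (68, [69,73]),
     (69, [70,74]), (70, [75]), (71, [73,74]), (72, [74,75,108]), (73, [75]),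
     (76, [77,81,107]), (77, [78,82]), (78, [83]), (79, [81,82,87]), (80, [82,83,85]),
     (81, [83]), (84, [85,86,87]), (85, [90]), (86, [88,96]), (87, [104]),
     (88, [89,93]), (89, [90,94]), (90, [95]), (91, [93,94,98]), (92, [94,95]),
     (93, [95]), (96, [97,101]), (97, [98,102]), (98, [103]), (99, [101,102,106]),
     (100, [102,103]), (101, [103]), (104, [105,109]), (105, [106,110]), (106, [111]),
     (107, [109,110]), (108, [110,111]), (109, [111])]"

definition explicit_edges :: "nat set set" where
  "explicit_edges = {{u, v} | u v. \<exists>vs. (u, vs) \<in> set larger_neighbors \<and> v \<in> set vs}"

end

theory Submission
  imports Defs
begin

text \<open>
  Mapping a vertex to the complement of the set of its three colors turns a normal 5-edge-coloring
  into a Petersen coloring, so it suffices to exclude the latter. The graph contains twelve copies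
  of a gadget, the Petersen graph minus two adjacent vertices. Four gadgets around a claw form a
  block with four dangling edges, and three such blocks and a fourth claw make up the whole graph.
  In a Petersen coloring every edge is labelled with one of the 15 edges of the Petersen graph. An
  exhaustive search determines which labels can occur on the dangling edges of a gadget; from this
  one obtains the possible labels on the dangling edges of a block, and finally sees that the
  requirements of the three blocks are incompatible at the fourth claw.

  For 3-connectivity, the vertices are ordered such that each one (except for three initial ones)
  has three paths, disjoint except for their origin, to different earlier vertices. After deleting
  at most two vertices or edges, every remaining vertex can still reach an earlier one.

  The digest is computed with lists of bits, for which the operations of SHA-256 are structural
  recursions.
\<close>

section \<open>SHA-256 on lists of bits\<close>

text \<open>Every finite check is carried out by rewriting, which dictates its size. A search over
  168 edges with 15 labels each would be far too large, so a gadget or a block enters the next stage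
  only through the relation between the labels at its four ports, tabulated by
  \<open>gadget_ports\<close> and \<open>block_ports\<close>. These tables bound the possible labels
  from above, which is enough to prove that no coloring exists. The two wires of a gadget have a
  simple origin: in the Petersen graph, the ports 0 and 4 are the neighbors of one deleted vertex,
  and the ports 2 and 3 are those of the other.\<close>

text \<open>Bit lists start with the least significant bit.\<close>

definition word_of_bits :: "bool list \<Rightarrow> 'a::len word" where
  "word_of_bits = horner_sum of_bool 2"

definition bits_of_word :: "'a::len word \<Rightarrow> bool list" where
  "bits_of_word w = map (bit w) [0..<LENGTH('a)]"

definition xor3 :: "bool \<Rightarrow> bool \<Rightarrow> bool \<Rightarrow> bool" where
  "xor3 a b c \<longleftrightarrow> (a \<noteq> b) \<noteq> c"

fun bits_xor3 :: "bool list \<Rightarrow> bool list \<Rightarrow> bool list \<Rightarrow> bool list" where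
  "bits_xor3 (x # xs) (y # ys) (z # zs) = xor3 x y z # bits_xor3 xs ys zs"
| "bits_xor3 _ _ _ = []"

fun bits_ch :: "bool list \<Rightarrow> bool list \<Rightarrow> bool list \<Rightarrow> bool list" where
  "bits_ch (True # xs) (y # ys) (z # zs) = y # bits_ch xs ys zs"
| "bits_ch (False # xs) (y # ys) (z # zs) = z # bits_ch xs ys zs"
| "bits_ch _ _ _ = []"

fun bits_maj :: "bool list \<Rightarrow> bool list \<Rightarrow> bool list \<Rightarrow> bool list" where
  "bits_maj (True # xs) (True # ys) (z # zs) = True # bits_maj xs ys zs"
| "bits_maj (True # xs) (False # ys) (z # zs) = z # bits_maj xs ys zs"
| "bits_maj (False # xs) (True # ys) (z # zs) = z # bits_maj xs ys zs"
| "bits_maj (False # xs) (False # ys) (z # zs) = False # bits_maj xs ys zs"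
| "bits_maj _ _ _ = []"

text \<open>Ripple-carry adder whose first argument is the incoming carry. The last carry is
  dropped, which is the reduction modulo a power of two. One equation for each combination of bits
  makes every digit a single rewrite.\<close>

fun bits_add :: "bool \<Rightarrow> bool list \<Rightarrow> bool list \<Rightarrow> bool list" where
  "bits_add True (True # xs) (True # ys) = True # bits_add True xs ys"
| "bits_add True (True # xs) (False # ys) = False # bits_add True xs ys"
| "bits_add True (False # xs) (True # ys) = False # bits_add True xs ys"
| "bits_add True (False # xs) (False # ys) = True # bits_add False xs ys"
| "bits_add False (True # xs) (True # ys) = False # bits_add True xs ys"
| "bits_add False (True # xs) (False # ys) = True # bits_add False xs ys"
| "bits_add False (False # xs) (True # ys) = True # bits_add False xs ys"
| "bits_add False (False # xs) (False # ys) = False # bits_add False xs ys"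
| "bits_add _ _ _ = []"

abbreviation badd :: "bool list \<Rightarrow> bool list \<Rightarrow> bool list" where
  "badd \<equiv> bits_add False"

text \<open>With the least significant bit in front, this is rotation to the right.\<close>

definition rot :: "nat \<Rightarrow> bool list \<Rightarrow> bool list" where
  "rot n x = drop n x @ take n x"

definition bits_Sigma0 :: "bool list \<Rightarrow> bool list" where
  "bits_Sigma0 x = bits_xor3 (rot 2 x) (rot 13 x) (rot 22 x)"

definition bits_Sigma1 :: "bool list \<Rightarrow> bool list" where
  "bits_Sigma1 x = bits_xor3 (rot 6 x) (rot 11 x) (rot 25 x)"

definition bits_sigma0 :: "bool list \<Rightarrow> bool list" where
  "bits_sigma0 x = bits_xor3 (rot 7 x) (rot 18 x) (drop 3 x @ [False, False, False])"

definition bits_sigma1 :: "bool list \<Rightarrow> bool list" where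
  "bits_sigma1 x = bits_xor3 (rot 17 x) (rot 19 x) (drop 10 x @
  [False, False, False, False, False, False, False, False, False, False])"

text \<open>The second argument is the list of zeros to be overwritten; its length is the word length.\<close>

fun bits_of_num :: "num \<Rightarrow> bool list \<Rightarrow> bool list" where
  "bits_of_num num.One (z # zs) = True # zs"
| "bits_of_num (num.Bit0 n) (z # zs) = False # bits_of_num n zs"
| "bits_of_num (num.Bit1 n) (z # zs) = True # bits_of_num n zs"
| "bits_of_num _ [] = []"

text \<open>The first argument is the value T1 of \<open>sha_round\<close>, which occurs twice on
  the right. As an argument it is brought to normal form before it is duplicated.\<close>

fun bits_step :: "bool list \<Rightarrow> bool list list \<Rightarrow> bool list list" where
  "bits_step t [a, b, c, d, e, f, g, h] =
     [badd t (badd (bits_Sigma0 a) (bits_maj a b c)), a, b, c, badd d t, e, f, g]"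
| "bits_step t s = s"

fun bits_round :: "bool list \<Rightarrow> bool list \<Rightarrow> bool list list \<Rightarrow> bool list list" where
  "bits_round k w [a, b, c, d, e, f, g, h] =
     bits_step (badd (badd (badd (badd h (bits_Sigma1 e)) (bits_ch e f g)) k) w) [a, b, c, d, e, f, g, h]"
| "bits_round k w s = s"

text \<open>For a window of 16 words, the positions t - 2, t - 7, t - 15 and t - 16 of
  \<open>sha_extend\<close> are 14, 9, 1 and 0.\<close>

definition bits_extend :: "bool list list \<Rightarrow> bool list" where
  "bits_extend ws = badd (badd (badd (bits_sigma1 (ws ! 14)) (ws ! 9)) (bits_sigma0 (ws ! 1))) (ws ! 0)"

fun bits_rounds :: "bool list list \<Rightarrow> bool list list \<Rightarrow> bool list list \<Rightarrow> bool list list" where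
  "bits_rounds (k # ks) (w # ws) s = bits_rounds ks ws (bits_round k w s)"
| "bits_rounds _ _ s = s"

text \<open>\<open>ks\<close> is meant for the first 48 round constants and \<open>ls\<close> for
  the last 16. Each of the 48 rounds shifts the window by one word; the window then left holds
  exactly the words of the last 16 rounds.\<close>

primrec bits_schedule_rounds ::
  "bool list list \<Rightarrow> bool list list \<Rightarrow> bool list list \<Rightarrow> bool list list \<Rightarrow> bool list list" where
  "bits_schedule_rounds [] ls ws s = bits_rounds ls ws s"
| "bits_schedule_rounds (k # ks) ls ws s =
     bits_schedule_rounds ks ls (tl ws @ [bits_extend ws]) (bits_round k (hd ws) s)"

fun bits_adds :: "bool list list \<Rightarrow> bool list list \<Rightarrow> bool list list" where
  "bits_adds (x # xs) (y # ys) = badd x y # bits_adds xs ys"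
| "bits_adds _ _ = []"

primrec bits_hash ::
  "bool list list \<Rightarrow> bool list list \<Rightarrow> bool list list list \<Rightarrow> bool list list \<Rightarrow> bool list list" where
  "bits_hash ks ls [] s = s"
| "bits_hash ks ls (ws # wss) s = bits_hash ks ls wss (bits_adds s (bits_schedule_rounds ks ls ws s))"

section \<open>Correctness of the bit operations with respect to words\<close>

lemma bit_word_of_bits:
  "length xs = LENGTH('a) \<Longrightarrow> bit (word_of_bits xs :: 'a::len word) n \<longleftrightarrow> n < LENGTH('a) \<and> xs ! n"
  by (simp add: word_of_bits_def bit_horner_sum_bit_word_iff)

lemma word_of_bits_of_word [simp]: "word_of_bits (bits_of_word w) = w"
  by (simp add: word_of_bits_def bits_of_word_def horner_sum_bit_eq_take_bit)

lemma length_bits_of_word [simp]: "length (bits_of_word (w :: 'a::len word)) = LENGTH('a)"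
  by (simp add: bits_of_word_def)

lemma length_bits_xor3 [simp]: "length (bits_xor3 xs ys zs) = min (length xs) (min (length ys) (length zs))"
  by (induction xs ys zs rule: bits_xor3.induct) auto

lemma nth_bits_xor3:
  "i < length xs \<Longrightarrow> i < length ys \<Longrightarrow> i < length zs \<Longrightarrow>
    bits_xor3 xs ys zs ! i = xor3 (xs ! i) (ys ! i) (zs ! i)"
  by (induction xs ys zs arbitrary: i rule: bits_xor3.induct) (auto simp: nth_Cons split: nat.split)

lemma length_bits_ch [simp]: "length (bits_ch xs ys zs) = min (length xs) (min (length ys) (length zs))"
  by (induction xs ys zs rule: bits_ch.induct) auto

lemma nth_bits_ch:
  "i < length xs \<Longrightarrow> i < length ys \<Longrightarrow> i < length zs \<Longrightarrow>
    bits_ch xs ys zs ! i = (if xs ! i then ys ! i else zs ! i)"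
  by (induction xs ys zs arbitrary: i rule: bits_ch.induct) (auto simp: nth_Cons split: nat.split)

lemma length_bits_maj [simp]: "length (bits_maj xs ys zs) = min (length xs) (min (length ys) (length zs))"
  by (induction xs ys zs rule: bits_maj.induct) auto

lemma nth_bits_maj:
  "i < length xs \<Longrightarrow> i < length ys \<Longrightarrow> i < length zs \<Longrightarrow>
    bits_maj xs ys zs ! i = (if xs ! i = ys ! i then xs ! i else zs ! i)"
  by (induction xs ys zs arbitrary: i rule: bits_maj.induct) (auto simp: nth_Cons split: nat.split)

lemma length_bits_add [simp]: "length (bits_add c xs ys) = min (length xs) (length ys)"
  by (induction c xs ys rule: bits_add.induct) auto

lemma length_rot [simp]: "length (rot n xs) = length xs"
  by (simp add: rot_def)

lemma word_of_bits_xor3: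
  "length xs = LENGTH('a) \<Longrightarrow> length ys = LENGTH('a) \<Longrightarrow> length zs = LENGTH('a) \<Longrightarrow>
    (word_of_bits (bits_xor3 xs ys zs) :: 'a::len word) =
      xor (xor (word_of_bits xs) (word_of_bits ys)) (word_of_bits zs)"
  by (rule bit_eqI) (auto simp: bit_word_of_bits bit_simps nth_bits_xor3 xor3_def)

lemma word_of_bits_ch:
  "length xs = 32 \<Longrightarrow> length ys = 32 \<Longrightarrow> length zs = 32 \<Longrightarrow>
    word_of_bits (bits_ch xs ys zs) = sha_ch (word_of_bits xs) (word_of_bits ys) (word_of_bits zs)"
  by (rule bit_eqI) (auto simp: bit_word_of_bits bit_simps nth_bits_ch sha_ch_def)

lemma word_of_bits_maj:
  "length xs = 32 \<Longrightarrow> length ys = 32 \<Longrightarrow> length zs = 32 \<Longrightarrow>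
    word_of_bits (bits_maj xs ys zs) = sha_maj (word_of_bits xs) (word_of_bits ys) (word_of_bits zs)"
  by (rule bit_eqI) (auto simp: bit_word_of_bits bit_simps nth_bits_maj sha_maj_def)

text \<open>Induction shortens the lists, whereas the length of a word is fixed by its type. The
  claim is therefore made in an arbitrary commutative ring, with the overflow kept as a multiple of
  a power of two; in words of matching length this power is 0.\<close>

lemma horner_sum_bits_add:
  "length xs = length ys \<Longrightarrow>
    \<exists>k. horner_sum of_bool 2 (bits_add c xs ys) + 2 ^ length xs * k =
      (horner_sum of_bool 2 xs + horner_sum of_bool 2 ys + of_bool c :: 'a::comm_ring_1)"
proof (induction xs ys arbitrary: c rule: list_induct2)
  case Nil
  \<comment> \<open>With no digits left, the incoming carry is the overflow.\<close>
  then show ?case by (auto intro: exI[of _ "of_bool c"])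
next
  case (Cons x xs y ys)
  let ?H = "horner_sum of_bool 2 :: bool list \<Rightarrow> 'a"
  define s where "s = xor3 x y c"
  define d where "d \<longleftrightarrow> x \<and> y \<or> x \<and> c \<or> y \<and> c"
  have eq: "bits_add c (x # xs) (y # ys) = s # bits_add d xs ys"
    unfolding s_def d_def xor3_def by (cases c; cases x; cases y) simp_all
  have sum: "of_bool s + 2 * of_bool d = (of_bool x + of_bool y + of_bool c :: 'a)"
    unfolding s_def d_def xor3_def by (cases c; cases x; cases y) simp_all
  obtain k where k: "?H (bits_add d xs ys) + 2 ^ length xs * k = ?H xs + ?H ys + of_bool d"
    using Cons.IH by blast
  have "?H (bits_add c (x # xs) (y # ys)) + 2 ^ length (x # xs) * k =
      of_bool s + 2 * (?H (bits_add d xs ys) + 2 ^ length xs * k)"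
    by (simp add: eq algebra_simps)
  also have "\<dots> = (of_bool s + 2 * of_bool d) + 2 * (?H xs + ?H ys)"
    unfolding k by (simp only: algebra_simps)
  also have "\<dots> = ?H (x # xs) + ?H (y # ys) + of_bool c"
    unfolding sum by (simp add: algebra_simps)
  finally show ?case by blast
qed

lemma word_of_bits_add:
  assumes "length xs = LENGTH('a)" "length ys = LENGTH('a)"
  shows "(word_of_bits (badd xs ys) :: 'a::len word) = word_of_bits xs + word_of_bits ys"
  using horner_sum_bits_add[of xs ys False, where 'a = "'a word"] assms
  by (auto simp: word_of_bits_def)

lemma word_of_bits_rot:
  assumes "length xs = LENGTH('a)" "n < LENGTH('a)"
  shows "(word_of_bits (rot n xs) :: 'a::len word) = word_rotr n (word_of_bits xs)"
proof (rule bit_eqI)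
  fix i assume i: "possible_bit TYPE('a word) i"
  have "rot n xs = rotate n xs"
    using assms by (simp add: rot_def rotate_drop_take)
  then show "bit (word_of_bits (rot n xs) :: 'a word) i \<longleftrightarrow> bit (word_rotr n (word_of_bits xs :: 'a word)) i"
    using i assms by (simp add: bit_word_of_bits nth_rotate bit_word_rotr_iff add.commute)
qed

lemma word_of_bits_drop:
  assumes "length xs = LENGTH('a)" "n < LENGTH('a)"
  shows "(word_of_bits (drop n xs @ replicate n False) :: 'a::len word) = drop_bit n (word_of_bits xs)"
  by (rule bit_eqI) (use assms in \<open>auto simp: bit_word_of_bits bit_drop_bit_eq nth_append\<close>)

lemma word_of_bits_sigma:
  assumes "length x = 32"
  shows "word_of_bits (bits_Sigma0 x) = sha_Sigma0 (word_of_bits x)"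
    and "word_of_bits (bits_Sigma1 x) = sha_Sigma1 (word_of_bits x)"
    and "word_of_bits (bits_sigma0 x) = sha_sigma0 (word_of_bits x)"
    and "word_of_bits (bits_sigma1 x) = sha_sigma1 (word_of_bits x)"
  using assms word_of_bits_drop[of x 3, where 'a = 32] word_of_bits_drop[of x 10, where 'a = 32]
  by (simp_all add: bits_Sigma0_def bits_Sigma1_def bits_sigma0_def bits_sigma1_def sha_Sigma0_def
      sha_Sigma1_def sha_sigma0_def sha_sigma1_def word_of_bits_xor3 word_of_bits_rot numeral_eq_Suc)

lemma length_bits_sigma:
  assumes "length x = 32"
  shows "length (bits_Sigma0 x) = 32" "length (bits_Sigma1 x) = 32"
    "length (bits_sigma0 x) = 32" "length (bits_sigma1 x) = 32"
  using assms by (simp_all add: bits_Sigma0_def bits_Sigma1_def bits_sigma0_def bits_sigma1_def)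

abbreviation words_of_bits :: "bool list list \<Rightarrow> word32 list" where
  "words_of_bits \<equiv> map word_of_bits"

definition bit_words :: "nat \<Rightarrow> bool list list \<Rightarrow> bool" where
  "bit_words n xs \<longleftrightarrow> length xs = n \<and> (\<forall>x\<in>set xs. length x = 32)"

section \<open>Rounds, message schedule and compression on bit lists\<close>

lemma bit_words_round:
  assumes "bit_words 8 s" "length k = 32" "length w = 32"
  shows "bit_words 8 (bits_round k w s)"
    and "words_of_bits (bits_round k w s) = sha_round (word_of_bits k, word_of_bits w) (words_of_bits s)"
proof -
  obtain a b c d e f g h where s: "s = [a, b, c, d, e, f, g, h]"
    using assms(1) by (auto simp: bit_words_def numeral_eq_Suc length_Suc_conv)
  show "bit_words 8 (bits_round k w s)"
    and "words_of_bits (bits_round k w s) = sha_round (word_of_bits k, word_of_bits w) (words_of_bits s)"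
    using assms by (simp_all add: s bit_words_def length_bits_sigma word_of_bits_add word_of_bits_sigma
        word_of_bits_ch word_of_bits_maj Let_def)
qed

lemma length_bits_extend: "bit_words 16 ws \<Longrightarrow> length (bits_extend ws) = 32"
  by (simp add: bit_words_def bits_extend_def length_bits_sigma)

lemma length_sha_extend: "length (sha_extend ws) = Suc (length ws)"
  by (simp add: sha_extend_def Let_def)

text \<open>Since only the last 16 words of the schedule matter for its extension, a window of 16 words
  that moves along with the rounds replaces the schedule.\<close>

lemma sha_extend_append: "16 \<le> length ws \<Longrightarrow> sha_extend (us @ ws) = us @ sha_extend ws"
proof -
  assume "16 \<le> length ws"
  then have "(us @ ws) ! (length (us @ ws) - k) = ws ! (length ws - k)" if "k \<in> {1..16}" for k
    using that by (auto simp: nth_append)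
  then show ?thesis by (simp add: sha_extend_def Let_def del: length_append)
qed

lemma sha_extend_funpow_append:
  "16 \<le> length ws \<Longrightarrow> (sha_extend ^^ n) (us @ ws) = us @ (sha_extend ^^ n) ws"
  by (induction n arbitrary: ws)
    (simp_all add: funpow_Suc_right sha_extend_append length_sha_extend del: funpow.simps(2))

lemma sha_extend_word_of_bits:
  "bit_words 16 ws \<Longrightarrow> sha_extend (words_of_bits ws) = words_of_bits (ws @ [bits_extend ws])"
  by (simp add: bit_words_def sha_extend_def bits_extend_def Let_def word_of_bits_add
      word_of_bits_sigma length_bits_sigma)

lemma bits_rounds:
  assumes "bit_words 8 s" "\<forall>k\<in>set ks. length k = 32" "bit_words (length ks) ws"
  shows "bit_words 8 (bits_rounds ks ws s)"
    and "words_of_bits (bits_rounds ks ws s) =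
      fold sha_round (zip (words_of_bits ks) (words_of_bits ws)) (words_of_bits s)"
proof -
  have "bit_words 8 (bits_rounds ks ws s) \<and> words_of_bits (bits_rounds ks ws s) =
      fold sha_round (zip (words_of_bits ks) (words_of_bits ws)) (words_of_bits s)"
    using assms
  proof (induction ks arbitrary: ws s)
    case (Cons k ks)
    obtain w ws' where ws: "ws = w # ws'"
      using Cons.prems(3) by (cases ws) (auto simp: bit_words_def)
    have wf: "length k = 32" "length w = 32" "bit_words (length ks) ws'" "\<forall>k\<in>set ks. length k = 32"
      using Cons.prems(2,3) unfolding ws bit_words_def by simp_all
    note r = bit_words_round[OF Cons.prems(1) wf(1,2)]
    show ?case
      using Cons.IH[OF r(1) wf(4,3)] by (simp only: ws bits_rounds.simps r(2) list.map zip_Cons_Cons fold_simps)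
  qed simp
  then show "bit_words 8 (bits_rounds ks ws s)"
    and "words_of_bits (bits_rounds ks ws s) =
      fold sha_round (zip (words_of_bits ks) (words_of_bits ws)) (words_of_bits s)"
    by auto
qed

lemma bits_schedule_rounds:
  assumes "bit_words 8 s" "\<forall>k\<in>set ks. length k = 32" "bit_words 16 ls" "bit_words 16 ws"
  shows "bit_words 8 (bits_schedule_rounds ks ls ws s) \<and>
    words_of_bits (bits_schedule_rounds ks ls ws s) =
      fold sha_round (zip (words_of_bits (ks @ ls)) ((sha_extend ^^ length ks) (words_of_bits ws)))
        (words_of_bits s)"
  using assms
proof (induction ks arbitrary: ws s)
  case Nil
  then show ?case
    using bits_rounds[of s ls ws] by (simp add: bit_words_def)
next
  case (Cons k ks)
  obtain w ws' where ws: "ws = w # ws'" "length ws' = 15"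
    using Cons.prems(4) by (cases ws) (auto simp: bit_words_def)
  let ?ws = "ws' @ [bits_extend ws]"
  have wf: "bit_words 16 ?ws"
    using Cons.prems ws length_bits_extend[of ws] by (auto simp: bit_words_def)
  \<comment> \<open>The schedule starts with \<open>w\<close>, the word consumed by this round; what
    follows is the schedule generated by the shifted window.\<close>
  have "(sha_extend ^^ length (k # ks)) (words_of_bits ws) =
      (sha_extend ^^ length ks) (words_of_bits [w] @ words_of_bits ?ws)"
    using sha_extend_word_of_bits[OF Cons.prems(4)] by (simp add: funpow_swap1 ws(1))
  also have "\<dots> = word_of_bits w # (sha_extend ^^ length ks) (words_of_bits ?ws)"
    using sha_extend_funpow_append[of "words_of_bits ?ws" "length ks" "words_of_bits [w]"] ws(2) by simp
  finally have sched: "(sha_extend ^^ length (k # ks)) (words_of_bits ws) = \<dots>" .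
  have wf': "length k = 32" "length w = 32" "\<forall>k\<in>set ks. length k = 32"
    using Cons.prems(2,4) unfolding ws(1) bit_words_def by simp_all
  note r = bit_words_round[OF Cons.prems(1) wf'(1,2)]
  have rounds: "bits_schedule_rounds (k # ks) ls ws s = bits_schedule_rounds ks ls ?ws (bits_round k w s)"
    by (simp add: ws(1))
  show ?case
    using Cons.IH[OF r(1) wf'(3) Cons.prems(3) wf]
    by (simp only: rounds sched r(2) append_Cons list.map zip_Cons_Cons fold_simps)
qed

lemma bits_adds:
  assumes "bit_words n xs" "bit_words n ys"
  shows "bit_words n (bits_adds xs ys) \<and>
    words_of_bits (bits_adds xs ys) = map2 (+) (words_of_bits xs) (words_of_bits ys)"
proof -
  have "length xs = length ys" "\<forall>x\<in>set xs. length x = 32" "\<forall>y\<in>set ys. length y = 32"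
    using assms by (simp_all add: bit_words_def)
  then have "length (bits_adds xs ys) = length xs \<and> (\<forall>x\<in>set (bits_adds xs ys). length x = 32) \<and>
      words_of_bits (bits_adds xs ys) = map2 (+) (words_of_bits xs) (words_of_bits ys)"
    by (induction xs ys rule: list_induct2) (simp_all add: word_of_bits_add)
  then show ?thesis
    using assms(1) by (simp add: bit_words_def)
qed

lemma bits_hash:
  assumes "bit_words 8 s" "bit_words 48 ks" "bit_words 16 ls" "sha_K = words_of_bits (ks @ ls)"
    "\<forall>ws\<in>set wss. bit_words 16 ws"
  shows "words_of_bits (bits_hash ks ls wss s) =
    fold sha_compress (map words_of_bits wss) (words_of_bits s)"
  using assms(1,5)
proof (induction wss arbitrary: s)
  case (Cons ws wss)
  have schedule: "sha_schedule B = (sha_extend ^^ length ks) B" for B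
    using assms(2) unfolding sha_schedule_def bit_words_def by metis
  let ?t = "bits_schedule_rounds ks ls ws s"
  have "bit_words 8 s" "\<forall>k\<in>set ks. length k = 32" "bit_words 16 ls" "bit_words 16 ws"
    using Cons.prems assms(2,3) by (simp_all add: bit_words_def)
  note t = bits_schedule_rounds[OF this, folded assms(4) schedule]
  have u: "bit_words 8 (bits_adds s ?t)" "words_of_bits (bits_adds s ?t) = sha_compress (words_of_bits ws) (words_of_bits s)"
    using bits_adds[OF Cons.prems(1) conjunct1[OF t]] t by (simp_all only: sha_compress_def)
  have "\<forall>ws\<in>set wss. bit_words 16 ws"
    using Cons.prems(2) by simp
  from Cons.IH[OF u(1) this] show ?case
    by (simp only: u(2) bits_hash.simps fold_simps list.map)
qed simp

section \<open>From characters to message blocks\<close>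

definition bits_of_char :: "char \<Rightarrow> bool list" where
  "bits_of_char c = [digit0 c, digit1 c, digit2 c, digit3 c, digit4 c, digit5 c, digit6 c, digit7 c]"

text \<open>Bytes are combined in big-endian order while bits start with the least significant one,
  hence the reversal.\<close>

definition bits_of_chars :: "char list \<Rightarrow> bool list" where
  "bits_of_chars cs = concat (map bits_of_char (rev cs))"

lemma uint_word_of_bits:
  "length xs = LENGTH('a) \<Longrightarrow> uint (word_of_bits xs :: 'a::len word) = horner_sum of_bool 2 xs"
  by (rule bit_eqI) (auto simp: bit_uint_iff bit_word_of_bits bit_horner_sum_bit_iff)

lemma uint_of_char: "uint (of_char c :: byte) = horner_sum of_bool 2 (bits_of_char c)"
  using uint_word_of_bits[of "bits_of_char c", where 'a = 8]
  by (simp add: of_char_def word_of_bits_def bits_of_char_def)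

lemma word_rcat_of_chars:
  "(word_rcat (map of_char cs :: byte list) :: 'a::len word) = word_of_bits (bits_of_chars cs)"
proof -
  have "horner_sum uint (2 ^ 8) (map of_char cs :: byte list) =
      horner_sum of_bool (2::int) (concat (map bits_of_char cs))" for cs
    by (induction cs) (simp_all add: uint_of_char horner_sum_append bits_of_char_def)
  moreover have "(word_of_int (horner_sum of_bool 2 bs) :: 'a word) = horner_sum of_bool 2 bs" for bs
    by (induction bs) simp_all
  ultimately show ?thesis
    by (simp add: word_rcat_def bits_of_chars_def word_of_bits_def rev_map)
qed

lemma chunks_map: "chunks n (map f xs) = map (map f) (chunks n xs)"
proof (induction n xs rule: chunks.induct)
  case (1 n xs)
  then show ?case
    by (subst (1 2) chunks.simps) (auto simp: take_map drop_map)
qed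

lemma sha_blocks_of_chars:
  assumes "sha_pad m = map of_char cs"
  shows "sha_blocks m = map words_of_bits (chunks 16 (map bits_of_chars (chunks 4 cs)))"
  by (simp add: sha_blocks_def assms chunks_map word_rcat_of_chars comp_def)

lemma bits_of_word_numeral:
  "bits_of_word (numeral n :: 'a::len word) = bits_of_num n (replicate LENGTH('a) False)"
proof -
  have "map (bit (numeral n :: int)) [0..<k] = bits_of_num n (replicate k False)" for k
  proof (induction k arbitrary: n)
    case (Suc k)
    have "[0..<Suc k] = 0 # map Suc [0..<k]"
      by (simp add: map_Suc_upt upt_conv_Cons)
    then show ?case
      by (cases n) (use Suc in \<open>simp_all add: comp_def bit_0 bit_Suc map_replicate_const\<close>)
  qed (cases n; simp)
  moreover have "bits_of_word (numeral n :: 'a word) = map (bit (numeral n :: int)) [0..<LENGTH('a)]"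
    unfolding bits_of_word_def by (rule map_cong[OF refl]) simp
  ultimately show ?thesis by simp
qed

definition edge_list :: "(nat \<times> nat) list" where
  "edge_list = concat (map (\<lambda>(u, vs). map (Pair u) vs) larger_neighbors)"

definition edge_list_text :: string where
  "edge_list_text =
     ''[[0,1],[0,5],[0,31],[1,2],[1,6],[2,7],[2,100],[3,5],[3,6],[3,11],[4,6],[4,7],[4,9],'' @
     ''[5,7],[8,9],[8,10],[8,11],[9,14],[10,12],[10,20],[11,28],[12,13],[12,17],[13,14],'' @
     ''[13,18],[14,19],[15,17],[15,18],[15,22],[16,18],[16,19],[16,56],[17,19],[20,21],'' @
     ''[20,25],[21,22],[21,26],[22,27],[23,25],[23,26],[23,30],[24,26],[24,27],[24,39],'' @
     ''[25,27],[28,29],[28,33],[29,30],[29,34],[30,35],[31,33],[31,34],[32,34],[32,35],'' @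
     ''[32,37],[33,35],[36,37],[36,38],[36,39],[37,42],[38,64],[38,92],[39,78],[40,41],'' @
     ''[40,45],[40,71],[41,42],[41,46],[42,47],[43,45],[43,46],[43,51],[44,46],[44,47],'' @
     ''[44,49],[45,47],[48,49],[48,50],[48,51],[49,54],[50,52],[50,60],[51,68],[52,53],'' @
     ''[52,57],[53,54],[53,58],[54,59],[55,57],[55,58],[55,62],[56,58],[56,59],[57,59],'' @
     ''[60,61],[60,65],[61,62],[61,66],[62,67],[63,65],[63,66],[63,70],[64,66],[64,67],'' @
     ''[65,67],[68,69],[68,73],[69,70],[69,74],[70,75],[71,73],[71,74],[72,74],[72,75],'' @
     ''[72,108],[73,75],[76,77],[76,81],[76,107],[77,78],[77,82],[78,83],[79,81],[79,82],'' @
     ''[79,87],[80,82],[80,83],[80,85],[81,83],[84,85],[84,86],[84,87],[85,90],[86,88],'' @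
     ''[86,96],[87,104],[88,89],[88,93],[89,90],[89,94],[90,95],[91,93],[91,94],[91,98],'' @
     ''[92,94],[92,95],[93,95],[96,97],[96,101],[97,98],[97,102],[98,103],[99,101],'' @
     ''[99,102],[99,106],[100,102],[100,103],[101,103],[104,105],[104,109],[105,106],'' @
     ''[105,110],[106,111],[107,109],[107,110],[108,110],[108,111],[109,111]]''"

lemma edge_list_text:
  "json_array (map (\<lambda>(u, v). json_array [decimal u, decimal v]) edge_list) = edge_list_text"
  by code_simp

text \<open>The text has 1351 characters, and 0x2A38 is 10808 = 8 * 1351.\<close>

definition padded_string :: string where
  "padded_string = edge_list_text @ [CHR 0x80] @ replicate 54 (CHR 0x00) @ [CHR 0x2A, CHR 0x38]"

\<comment> \<open>The block equations \<open>chunks_4\<close> and \<open>chunks_16\<close> match on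
  explicit list cells, so a literal list of characters is needed; evaluation fills it in.\<close>
schematic_goal padded_string_eq: "padded_string = ?s"
  by (simp add: padded_string_def edge_list_text_def numeral_eq_Suc)

lemma big_endian_bytes_10808: "big_endian_bytes (10808 :: 64 word) = [0, 0, 0, 0, 0, 0, 0x2A, 0x38]"
  by (simp add: big_endian_bytes_def upt_conv_Cons)

lemma sha_pad_edge_list_text: "sha_pad (ascii_bytes edge_list_text) = map of_char padded_string"
proof -
  have len: "length (ascii_bytes edge_list_text) = 1351"
    by (simp add: edge_list_text_def ascii_bytes_def)
  \<comment> \<open>The 54 zero bytes are 48 bytes of padding and the six leading zero bytes of the
    64-bit length. Altogether 1351 + 1 + 48 + 8 = 1408 bytes make up 22 blocks.\<close>
  have zeros: "replicate 54 x = replicate 48 x @ [x, x, x, x, x, x]" for x :: byte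
    by (simp add: numeral_eq_Suc)
  have bytes: "of_char (CHR 0x80) = (0x80 :: byte)" "of_char (CHR 0x00) = (0 :: byte)"
     "of_char (CHR 0x2A) = (0x2A :: byte)" "of_char (CHR 0x38) = (0x38 :: byte)"
    by simp_all
  have n: "nat ((55 - int 1351) mod 64) = 48" "8 * 1351 = (10808 :: nat)" "of_nat 10808 = (10808 :: 64 word)"
    by simp_all
  show ?thesis
    unfolding sha_pad_def len unfolding n big_endian_bytes_10808 padded_string_def
      map_append map_replicate list.map bytes zeros
      ascii_bytes_def append_assoc append.simps ..
qed

lemma bits_of_word32_numeral:
  "bits_of_word (numeral n :: word32) = bits_of_num n
    [False, False, False, False, False, False, False, False, False, False, False,
     False, False, False, False, False, False, False, False, False, False, False,
     False, False, False, False, False, False, False, False, False, False]"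
  by (simp add: bits_of_word_numeral numeral_eq_Suc)

lemmas bits_of_num_simps = bits_of_num.simps bits_of_word32_numeral

schematic_goal bits_of_ks: "map bits_of_word (take 48 sha_K) = ?k"
  by (simp add: sha_K_def bits_of_num_simps)

schematic_goal bits_of_ls: "map bits_of_word (drop 48 sha_K) = ?k"
  by (simp add: sha_K_def bits_of_num_simps)

schematic_goal bits_of_H0: "map bits_of_word sha_H0 = ?k"
  by (simp add: sha_H0_def bits_of_num_simps)

lemma chunks_4: "chunks 4 (a # b # c # d # xs) = [a, b, c, d] # chunks 4 xs" "chunks n [] = []"
  by (subst chunks.simps; simp)+

lemma chunks_16:
  "chunks 16 (w0 # w1 # w2 # w3 # w4 # w5 # w6 # w7 # w8 # w9 # w10 # w11 # 
      w12 # w13 # w14 # w15 # xs) =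
    [w0, w1, w2, w3, w4, w5, w6, w7, w8, w9, w10, w11, w12, w13, w14, w15] # chunks 16 xs"
  by (subst chunks.simps; simp)

schematic_goal padded_bits: "chunks 16 (map bits_of_chars (chunks 4 padded_string)) = ?k"
  unfolding padded_string_eq
  by (simp only: chunks_4 chunks_16 list.map bits_of_chars_def rev.simps append.simps concat.simps
      bits_of_char_def char.sel)

text \<open>Rotations and shifts are resolved once, for 32 symbolic bits. Each later use is then a
  rewrite free of \<open>drop\<close> and \<open>take\<close>.\<close>

lemmas bits_sigma_eqs =
  bits_Sigma0_def[of "[a0, a1, a2, a3, a4, a5, a6, a7, a8, a9, a10, a11, a12, a13, a14, a15,
      a16, a17, a18, a19, a20, a21, a22, a23, a24, a25, a26, a27, a28, a29, a30, a31]", unfolded rot_def, simplified]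
  bits_Sigma1_def[of "[a0, a1, a2, a3, a4, a5, a6, a7, a8, a9, a10, a11, a12, a13, a14, a15,
      a16, a17, a18, a19, a20, a21, a22, a23, a24, a25, a26, a27, a28, a29, a30, a31]", unfolded rot_def, simplified]
  bits_sigma0_def[of "[a0, a1, a2, a3, a4, a5, a6, a7, a8, a9, a10, a11, a12, a13, a14, a15,
      a16, a17, a18, a19, a20, a21, a22, a23, a24, a25, a26, a27, a28, a29, a30, a31]", unfolded rot_def, simplified]
  bits_sigma1_def[of "[a0, a1, a2, a3, a4, a5, a6, a7, a8, a9, a10, a11, a12, a13, a14, a15,
      a16, a17, a18, a19, a20, a21, a22, a23, a24, a25, a26, a27, a28, a29, a30, a31]", unfolded rot_def, simplified]
  for a0 a1 a2 a3 a4 a5 a6 a7 a8 a9 a10 a11 a12 a13 a14 a15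
    a16 a17 a18 a19 a20 a21 a22 a23 a24 a25 a26 a27 a28 a29 a30 a31

text \<open>Naming the 16 words of the window removes \<open>hd\<close>, \<open>tl\<close>,
  \<open>!\<close> and \<open>@\<close> from the evaluation.\<close>

lemma bits_schedule_rounds_Cons:
  "bits_schedule_rounds (k # ks) ls
      [w0, w1, w2, w3, w4, w5, w6, w7, w8, w9, w10, w11, w12, w13, w14, w15] s =
    bits_schedule_rounds ks ls
      [w1, w2, w3, w4, w5, w6, w7, w8, w9, w10, w11, w12, w13, w14, w15,
       badd (badd (badd (bits_sigma1 w14) w9) (bits_sigma0 w1)) w0]
      (bits_round k w0 s)"
  by (simp add: bits_extend_def)

lemma xor3_simps:
  "xor3 True True True = True" "xor3 True True False = False"
  "xor3 True False True = False" "xor3 True False False = True"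
  "xor3 False True True = False" "xor3 False True False = True"
  "xor3 False False True = True" "xor3 False False False = False"
  by (simp_all add: xor3_def)

\<comment> \<open>The actual computation of the hash: all 22 compressions, evaluated with nothing
  but the equations for literal bits.\<close>
schematic_goal hash_bits: "bits_hash (map bits_of_word (take 48 sha_K)) (map bits_of_word (drop 48 sha_K))
   (chunks 16 (map bits_of_chars (chunks 4 padded_string))) (map bits_of_word sha_H0) = ?k"
  unfolding padded_bits bits_of_ks bits_of_ls bits_of_H0
  by (simp only: bits_hash.simps bits_schedule_rounds_Cons bits_schedule_rounds.simps(1) bits_rounds.simps
   bits_round.simps(1) bits_step.simps(1) bits_add.simps bits_ch.simps bits_maj.simps xor3_simps bits_sigma_eqs
   bits_adds.simps)

lemma sha256_edge_list_text:
  "hex_of_bytes (sha256 (ascii_bytes edge_list_text)) =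
    ''dc16cc18600cf77c8661b7baf89c7019f265299308541961ff884ea7187b4e8b''"
proof -
  have words: "bit_words 8 (map bits_of_word sha_H0)" "bit_words 48 (map bits_of_word (take 48 sha_K))"
     "bit_words 16 (map bits_of_word (drop 48 sha_K))"
    by (auto simp: bit_words_def sha_H0_def sha_K_def)
  have blocks: "\<forall>ws\<in>set (chunks 16 (map bits_of_chars (chunks 4 padded_string))). bit_words 16 ws"
    unfolding padded_bits bit_words_def by simp
  have K: "sha_K = words_of_bits (map bits_of_word (take 48 sha_K) @ map bits_of_word (drop 48 sha_K))"
    by (simp add: comp_def flip: map_append)
  have H0: "words_of_bits (map bits_of_word sha_H0) = sha_H0"
    by (simp add: comp_def)
  have "fold sha_compress (sha_blocks (ascii_bytes edge_list_text)) sha_H0 =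
    words_of_bits (bits_hash (map bits_of_word (take 48 sha_K)) (map bits_of_word (drop 48 sha_K))
      (chunks 16 (map bits_of_chars (chunks 4 padded_string))) (map bits_of_word sha_H0))"
    using bits_hash[OF words K blocks] by (simp only: sha_blocks_of_chars[OF sha_pad_edge_list_text] H0)
  also have "\<dots> = [0xdc16cc18, 0x600cf77c, 0x8661b7ba, 0xf89c7019, 0xf2652993, 0x08541961, 0xff884ea7, 0x187b4e8b]"
    unfolding hash_bits by (simp add: word_of_bits_def)
  finally have hash: "fold sha_compress (sha_blocks (ascii_bytes edge_list_text)) sha_H0 = \<dots>" .
  show ?thesis
    unfolding sha256_def hash by code_simp
qed

section \<open>The graph\<close>

definition explicit_graph :: "nat graph" where
  "explicit_graph = Graph {0..111} explicit_edges"

lemma explicit_graph_sel [simp]: "verts explicit_graph = {0..111}" "edges explicit_graph = explicit_edges"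
  by (simp_all add: explicit_graph_def)

schematic_goal edge_list_eq: "edge_list = ?es"
  by (simp add: edge_list_def larger_neighbors_def)

lemma mem_edge_list: "(u, v) \<in> set edge_list \<longleftrightarrow> (\<exists>vs. (u, vs) \<in> set larger_neighbors \<and> v \<in> set vs)"
  unfolding edge_list_def by auto

lemma explicit_edges_eq: "explicit_edges = (\<lambda>(u, v). {u, v}) ` set edge_list"
proof -
  have "explicit_edges = {{u, v} | u v. (u, v) \<in> set edge_list}"
    unfolding explicit_edges_def mem_edge_list ..
  also have "\<dots> = (\<lambda>(u, v). {u, v}) ` set edge_list"
    by auto
  finally show ?thesis .
qed

lemma mem_explicit_edges:
  "{u, v} \<in> explicit_edges \<longleftrightarrow> (u, v) \<in> set edge_list \<or> (v, u) \<in> set edge_list"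
proof -
  have "{u, v} \<in> explicit_edges \<longleftrightarrow> (\<exists>(a, b)\<in>set edge_list. {u, v} = {a, b})"
    unfolding explicit_edges_eq image_iff by (simp add: case_prod_beta)
  also have "\<dots> \<longleftrightarrow> (u, v) \<in> set edge_list \<or> (v, u) \<in> set edge_list"
    by (auto simp: doubleton_eq_iff)
  finally show ?thesis .
qed

lemma edge_list_bounds: "(u, v) \<in> set edge_list \<Longrightarrow> u < v \<and> v < 112"
proof -
  have "list_all (\<lambda>(u, v). u < v \<and> v < 112) edge_list"
    by code_simp
  then show "(u, v) \<in> set edge_list \<Longrightarrow> u < v \<and> v < 112"
    by (auto simp: list_all_iff)
qed

text \<open>By transitivity only consecutive pairs need to be compared, so the usual quadratic
  unfolding of \<open>sorted_wrt\<close> is replaced by a linear one.\<close>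

lemma strict_sorted_edge_list: "sorted_wrt (<) edge_list"
  unfolding edge_list_eq by (simp add: sorted_wrt1 sorted_wrt2 del: sorted_wrt.simps(2))

definition nbrs :: "nat \<Rightarrow> nat list" where
  "nbrs v = concat (map (\<lambda>(u, w). if u = v then [w] else if w = v then [u] else []) edge_list)"

lemma nbrs_eqs:
    "nbrs 0 = [1, 5, 31]" "nbrs 1 = [0, 2, 6]" "nbrs 2 = [1, 7, 100]" "nbrs 3 = [5, 6, 11]"
    "nbrs 4 = [6, 7, 9]" "nbrs 5 = [0, 3, 7]" "nbrs 6 = [1, 3, 4]" "nbrs 7 = [2, 4, 5]"
    "nbrs 8 = [9, 10, 11]" "nbrs 9 = [4, 8, 14]" "nbrs 10 = [8, 12, 20]" "nbrs 11 = [3, 8, 28]"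
    "nbrs 12 = [10, 13, 17]" "nbrs 13 = [12, 14, 18]" "nbrs 14 = [9, 13, 19]"
    "nbrs 15 = [17, 18, 22]" "nbrs 16 = [18, 19, 56]" "nbrs 17 = [12, 15, 19]"
    "nbrs 18 = [13, 15, 16]" "nbrs 19 = [14, 16, 17]" "nbrs 20 = [10, 21, 25]"
    "nbrs 21 = [20, 22, 26]" "nbrs 22 = [15, 21, 27]" "nbrs 23 = [25, 26, 30]"
    "nbrs 24 = [26, 27, 39]" "nbrs 25 = [20, 23, 27]" "nbrs 26 = [21, 23, 24]"
    "nbrs 27 = [22, 24, 25]" "nbrs 28 = [11, 29, 33]" "nbrs 29 = [28, 30, 34]"
    "nbrs 30 = [23, 29, 35]" "nbrs 31 = [0, 33, 34]" "nbrs 32 = [34, 35, 37]"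
    "nbrs 33 = [28, 31, 35]" "nbrs 34 = [29, 31, 32]" "nbrs 35 = [30, 32, 33]"
    "nbrs 36 = [37, 38, 39]" "nbrs 37 = [32, 36, 42]" "nbrs 38 = [36, 64, 92]"
    "nbrs 39 = [24, 36, 78]" "nbrs 40 = [41, 45, 71]" "nbrs 41 = [40, 42, 46]"
    "nbrs 42 = [37, 41, 47]" "nbrs 43 = [45, 46, 51]" "nbrs 44 = [46, 47, 49]"
    "nbrs 45 = [40, 43, 47]" "nbrs 46 = [41, 43, 44]" "nbrs 47 = [42, 44, 45]"
    "nbrs 48 = [49, 50, 51]" "nbrs 49 = [44, 48, 54]" "nbrs 50 = [48, 52, 60]"
    "nbrs 51 = [43, 48, 68]" "nbrs 52 = [50, 53, 57]" "nbrs 53 = [52, 54, 58]"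
    "nbrs 54 = [49, 53, 59]" "nbrs 55 = [57, 58, 62]" "nbrs 56 = [16, 58, 59]"
    "nbrs 57 = [52, 55, 59]" "nbrs 58 = [53, 55, 56]" "nbrs 59 = [54, 56, 57]"
    "nbrs 60 = [50, 61, 65]" "nbrs 61 = [60, 62, 66]" "nbrs 62 = [55, 61, 67]"
    "nbrs 63 = [65, 66, 70]" "nbrs 64 = [38, 66, 67]" "nbrs 65 = [60, 63, 67]"
    "nbrs 66 = [61, 63, 64]" "nbrs 67 = [62, 64, 65]" "nbrs 68 = [51, 69, 73]"
    "nbrs 69 = [68, 70, 74]" "nbrs 70 = [63, 69, 75]" "nbrs 71 = [40, 73, 74]"
    "nbrs 72 = [74, 75, 108]" "nbrs 73 = [68, 71, 75]" "nbrs 74 = [69, 71, 72]"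
    "nbrs 75 = [70, 72, 73]" "nbrs 76 = [77, 81, 107]" "nbrs 77 = [76, 78, 82]"
    "nbrs 78 = [39, 77, 83]" "nbrs 79 = [81, 82, 87]" "nbrs 80 = [82, 83, 85]"
    "nbrs 81 = [76, 79, 83]" "nbrs 82 = [77, 79, 80]" "nbrs 83 = [78, 80, 81]"
    "nbrs 84 = [85, 86, 87]" "nbrs 85 = [80, 84, 90]" "nbrs 86 = [84, 88, 96]"
    "nbrs 87 = [79, 84, 104]" "nbrs 88 = [86, 89, 93]" "nbrs 89 = [88, 90, 94]"
    "nbrs 90 = [85, 89, 95]" "nbrs 91 = [93, 94, 98]" "nbrs 92 = [38, 94, 95]"
    "nbrs 93 = [88, 91, 95]" "nbrs 94 = [89, 91, 92]" "nbrs 95 = [90, 92, 93]"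
    "nbrs 96 = [86, 97, 101]" "nbrs 97 = [96, 98, 102]" "nbrs 98 = [91, 97, 103]"
    "nbrs 99 = [101, 102, 106]" "nbrs 100 = [2, 102, 103]" "nbrs 101 = [96, 99, 103]"
    "nbrs 102 = [97, 99, 100]" "nbrs 103 = [98, 100, 101]" "nbrs 104 = [87, 105, 109]"
    "nbrs 105 = [104, 106, 110]" "nbrs 106 = [99, 105, 111]" "nbrs 107 = [76, 109, 110]"
    "nbrs 108 = [72, 110, 111]" "nbrs 109 = [104, 107, 111]" "nbrs 110 = [105, 107, 108]"
    "nbrs 111 = [106, 108, 109]"
  by (simp_all add: nbrs_def edge_list_eq)

text \<open>The simplifier turns the natural number 1 into \<open>Suc 0\<close>, and the table has
  to match this form.\<close>

lemmas nbrs_simps = nbrs_eqs[unfolded One_nat_def]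

lemma upt_112: "[0..<112] =
    [0, 1, 2, 3, 4, 5, 6, 7, 8, 9, 10, 11, 12, 13, 14, 15, 16, 17, 18, 19, 20, 21, 22, 23, 24,
    25, 26, 27, 28, 29, 30, 31, 32, 33, 34, 35, 36, 37, 38, 39, 40, 41, 42, 43, 44, 45, 46, 47,
    48, 49, 50, 51, 52, 53, 54, 55, 56, 57, 58, 59, 60, 61, 62, 63, 64, 65, 66, 67, 68, 69, 70,
    71, 72, 73, 74, 75, 76, 77, 78, 79, 80, 81, 82, 83, 84, 85, 86, 87, 88, 89, 90, 91, 92, 93,
    94, 95, 96, 97, 98, 99, 100, 101, 102, 103, 104, 105, 106, 107, 108, 109, 110, 111]"
  by code_simp

lemma mem_nbrs_iff: "w \<in> set (nbrs v) \<longleftrightarrow> {v, w} \<in> explicit_edges"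
proof
  assume "w \<in> set (nbrs v)"
  then show "{v, w} \<in> explicit_edges"
    by (auto simp: nbrs_def mem_explicit_edges split: if_splits)
next
  assume "{v, w} \<in> explicit_edges"
  then consider "(v, w) \<in> set edge_list" | "(w, v) \<in> set edge_list" "w \<noteq> v"
    by (auto simp: mem_explicit_edges dest: edge_list_bounds)
  then show "w \<in> set (nbrs v)"
  proof cases
    case 1
    then show ?thesis by (auto simp: nbrs_def intro!: bexI[of _ "(v, w)"])
  next
    case 2
    then show ?thesis by (auto simp: nbrs_def intro!: bexI[of _ "(w, v)"])
  qed
qed

lemma nbrs_less: "w \<in> set (nbrs v) \<Longrightarrow> v < 112 \<and> w < 112"
  unfolding mem_nbrs_iff mem_explicit_edges by (auto dest!: edge_list_bounds)

lemma simple_explicit_graph: "simple_graph explicit_graph"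
  unfolding simple_graph_def by (auto simp: explicit_edges_eq card_2_iff dest!: edge_list_bounds)

lemma inj_on_edge_list: "inj_on (\<lambda>(u, v). {u, v}) (set edge_list)"
  by (auto simp: inj_on_def doubleton_eq_iff dest!: edge_list_bounds)

lemma card_explicit_edges: "card explicit_edges = 168"
proof -
  have "distinct edge_list"
    using strict_sorted_edge_list by (simp add: strict_sorted_iff)
  moreover have "length edge_list = 168"
    unfolding edge_list_eq by simp
  ultimately show ?thesis
    unfolding explicit_edges_eq by (simp add: card_image[OF inj_on_edge_list] distinct_card)
qed

lemma incident_explicit_graph: "incident explicit_graph v = (\<lambda>w. {v, w}) ` set (nbrs v)"
proof -
  have "\<exists>w. e = {v, w}" if "e \<in> explicit_edges" "v \<in> e" for e
    using that unfolding explicit_edges_eq by auto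
  then have "incident explicit_graph v \<subseteq> {{v, w} | w. {v, w} \<in> explicit_edges}"
    by (fastforce simp: incident_def)
  then show ?thesis
    by (auto simp: incident_def mem_nbrs_iff)
qed

lemma nbrs_three: "v < 112 \<Longrightarrow> length (nbrs v) = 3 \<and> distinct (nbrs v)"
proof -
  have "\<forall>v\<in>set [0..<112]. length (nbrs v) = 3 \<and> distinct (nbrs v)"
    by (simp add: upt_112 nbrs_simps)
  then show "v < 112 \<Longrightarrow> ?thesis" by simp
qed

lemma card_incident_explicit_graph: "v < 112 \<Longrightarrow> card (incident explicit_graph v) = 3"
proof -
  assume "v < 112"
  moreover have "inj_on (\<lambda>w. {v, w}) (set (nbrs v))"
    by (auto simp: inj_on_def doubleton_eq_iff)
  ultimately show ?thesis
    using nbrs_three[of v] by (simp add: incident_explicit_graph card_image distinct_card)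
qed

lemma cubic_explicit_graph: "cubic explicit_graph"
  by (simp add: cubic_def card_incident_explicit_graph)

lemma sorted_edge_pairs_explicit_graph: "sorted_edge_pairs explicit_graph = edge_list"
proof -
  have "{(u, v). u < v \<and> {u, v} \<in> explicit_edges} = set edge_list"
    by (auto simp: mem_explicit_edges dest: edge_list_bounds)
  then show ?thesis
    using strict_sorted_edge_list
    by (simp add: sorted_edge_pairs_def strict_sorted_iff sorted_list_of_set.idem_if_sorted_distinct)
qed

lemma list_allD: "list_all P xs \<Longrightarrow> x \<in> set xs \<Longrightarrow> P x"
  by (simp add: list_all_iff)

text \<open>One search for both lengths: \<open>a \<notin> set (nbrs c)\<close> excludes triangles,
  the inner condition quadrilaterals. The alternatives \<open>c = a\<close> and \<open>d = b\<close>
  skip walks that merely turn back.\<close>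

lemma no_short_closed_walk:
  "list_all (\<lambda>a. list_all (\<lambda>b. list_all (\<lambda>c. c = a \<or> a \<notin> set (nbrs c) \<and>
     list_all (\<lambda>d. d = b \<or> a \<notin> set (nbrs d)) (nbrs c)) (nbrs b)) (nbrs a)) [0..<112]"
  by (simp add: upt_112 nbrs_simps)

lemma girth_explicit_graph: "girth explicit_graph = 5"
proof -
  have "5 \<le> length c" if c: "is_cycle explicit_graph c" for c
  proof (rule ccontr)
    assume "\<not> 5 \<le> length c"
    with c have len: "length c = 3 \<or> length c = 4"
      by (auto simp: is_cycle_def)
    have E: "c ! (Suc i mod length c) \<in> set (nbrs (c ! i))" if "i < length c" for i
      using c that by (simp add: is_cycle_def mem_nbrs_iff)
    have dist: "i < length c \<Longrightarrow> j < length c \<Longrightarrow> i \<noteq> j \<Longrightarrow> c ! i \<noteq> c ! j" for i j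
      using c by (simp add: is_cycle_def nth_eq_iff_index_eq)
    have l: "0 < length c" "1 < length c" "2 < length c"
      using len by auto
    define a where "a = c ! 0"
    define b where "b = c ! 1"
    define d where "d = c ! 2"
    have ab: "b \<in> set (nbrs a)" and bd: "d \<in> set (nbrs b)" and da: "d \<noteq> a"
      using E[OF l(1)] E[OF l(2)] dist[OF l(3,1)] len by (auto simp: a_def b_def d_def numeral_2_eq_2)
    have "a < 112" using nbrs_less[OF ab] by simp
    then have step: "a \<notin> set (nbrs d) \<and> (\<forall>x\<in>set (nbrs d). x = b \<or> a \<notin> set (nbrs x))"
      using list_allD[OF list_allD[OF list_allD[OF no_short_closed_walk] ab] bd] da
      by (simp add: list_all_iff)
    from len show False
    proof
      assume "length c = 3"
      then have "a \<in> set (nbrs d)"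
        using E[OF l(3)] by (simp add: a_def d_def)
      then show False using step by blast
    next
      assume l4: "length c = 4"
      then have l3: "3 < length c" by simp
      have "c ! 3 \<in> set (nbrs d)" "a \<in> set (nbrs (c ! 3))"
        using E[OF l(3)] E[OF l3] l4 by (simp_all add: a_def d_def)
      moreover have "c ! 3 \<noteq> b"
        using dist[OF l3 l(2)] by (simp add: b_def)
      ultimately show False using step by blast
    qed
  qed
  \<comment> \<open>A pentagon inside the gadget on the vertices 0 to 7.\<close>
  moreover have "is_cycle explicit_graph [0, 1, 6, 3, 5]"
  proof -
    have "{0, 1} \<in> explicit_edges" "{1, 6} \<in> explicit_edges" "{6, 3} \<in> explicit_edges"
      "{3, 5} \<in> explicit_edges" "{5, 0} \<in> explicit_edges"
      unfolding mem_nbrs_iff[symmetric] by (simp_all add: nbrs_simps)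
    moreover have "i < length [0::nat, 1, 6, 3, 5] \<Longrightarrow> i = 0 \<or> i = 1 \<or> i = 2 \<or> i = 3 \<or> i = 4" for i
      by auto
    ultimately have "{[0::nat, 1, 6, 3, 5] ! i, [0, 1, 6, 3, 5] ! (Suc i mod length [0::nat, 1, 6, 3, 5])} \<in> explicit_edges"
      if "i < length [0::nat, 1, 6, 3, 5]" for i
      using that by fastforce
    then show ?thesis by (simp add: is_cycle_def)
  qed
  ultimately show ?thesis
    unfolding girth_def
    by (intro antisym INF_lower2[of "[0, 1, 6, 3, 5]"] INF_greatest) (simp_all add: numeral_eq_enat)
qed

section \<open>Connectivity\<close>

fun walk :: "nat list \<Rightarrow> bool" where
  "walk (u # v # p) \<longleftrightarrow> v \<in> set (nbrs u) \<and> walk (v # p)"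
| "walk _ \<longleftrightarrow> True"

fun walk_edges :: "'a list \<Rightarrow> 'a set list" where
  "walk_edges (u # v # p) = {u, v} # walk_edges (v # p)"
| "walk_edges _ = []"

definition edge_disjoint :: "'a list \<Rightarrow> 'a list \<Rightarrow> bool" where
  "edge_disjoint p q \<longleftrightarrow> list_all (\<lambda>e. list_all (\<lambda>f. e \<noteq> f) (walk_edges q)) (walk_edges p)"

definition avoids :: "'a list \<Rightarrow> 'a list \<Rightarrow> bool" where
  "avoids p q \<longleftrightarrow> list_all (\<lambda>x. x \<notin> set q) p"

text \<open>A fan consists of three walks from a common vertex to K that are disjoint otherwise, so at least
  one of them survives the deletion of two vertices or two edges.\<close>

fun fan :: "nat list \<Rightarrow> nat list list \<Rightarrow> bool" where
  "fan K [u # p, v # q, w # r] \<longleftrightarrow> u = v \<and> v = w \<and> p \<noteq> [] \<and> q \<noteq> [] \<and> r \<noteq> [] \<and>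
     walk (u # p) \<and> walk (v # q) \<and> walk (w # r) \<and>
     last p \<in> set K \<and> last q \<in> set K \<and> last r \<in> set K \<and>
     avoids p q \<and> avoids p r \<and> avoids q r \<and>
     edge_disjoint (u # p) (v # q) \<and> edge_disjoint (u # p) (w # r) \<and> edge_disjoint (v # q) (w # r)"
| "fan K _ \<longleftrightarrow> False"

text \<open>Serves the initial vertices, which have no earlier ones to reach. The lists contain the
  inner vertices of three paths between \<open>a\<close> and \<open>b\<close>; an empty list stands
  for an edge.\<close>

fun link :: "nat \<Rightarrow> nat \<Rightarrow> nat list list \<Rightarrow> bool" where
  "link a b [p, q, r] \<longleftrightarrow>
     walk (a # p @ [b]) \<and> walk (a # q @ [b]) \<and> walk (a # r @ [b]) \<and>
     avoids p q \<and> avoids p r \<and> avoids q r \<and>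
     edge_disjoint (a # p @ [b]) (a # q @ [b]) \<and> edge_disjoint (a # p @ [b]) (a # r @ [b]) \<and>
     edge_disjoint (a # q @ [b]) (a # r @ [b])"
| "link a b _ \<longleftrightarrow> False"

fun fan_order :: "nat list \<Rightarrow> nat list list list \<Rightarrow> bool" where
  "fan_order K [] \<longleftrightarrow> True"
| "fan_order K (ps # pss) \<longleftrightarrow> fan K ps \<and> fan_order (hd (hd ps) # K) pss"

text \<open>The common head of an entry is the vertex that it adds. Only the last vertex of each
  walk has to be an earlier one; the interior may run through vertices that are added later.\<close>

definition fans :: "nat list list list" where
  "fans =
    [[[101,96], [101,99], [101,103]], [[97,96], [97,98,103], [97,102,99]],
     [[102,97], [102,99], [102,100,103]], [[98,91,93,88,86,96], [98,97], [98,103]],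
     [[86,84,87,104,105,106,99], [86,88,93,91,98], [86,96]],
     [[84,85,90,89,94,91,98], [84,86], [84,87,104,105,106,99]],
     [[89,88,86], [89,90,85,84], [89,94,91,98]], [[88,86], [88,89], [88,93,91,98]],
     [[91,93,88], [91,94,89], [91,98]], [[93,88], [93,91], [93,95,90,89]],
     [[90,85,84], [90,89], [90,95,93]], [[95,90], [95,92,94,89], [95,93]],
     [[94,89], [94,91], [94,92,95]], [[87,79,82,80,85,90], [87,84], [87,104,105,106,99]],
     [[85,80,82,79,87], [85,84], [85,90]], [[92,38,36,39,78,83,80,85], [92,94], [92,95]],
     [[82,77,78,39,36,38,92], [82,79,87], [82,80,85]], [[79,81,83,80,85], [79,82], [79,87]],
     [[80,82], [80,83,81,79], [80,85]], [[81,76,77,82], [81,79], [81,83,80]],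
     [[83,78,77,82], [83,80], [83,81]], [[77,76,81], [77,78,83], [77,82]],
     [[76,77], [76,81], [76,107,109,104,87]], [[78,39,36,38,92], [78,77], [78,83]],
     [[104,87], [104,105,106,99], [104,109,107,76]],
     [[109,104], [109,107,76], [109,111,106,99]], [[106,99], [106,105,104], [106,111,109]],
     [[105,104], [105,106], [105,110,107,76]], [[107,76], [107,109], [107,110,105]],
     [[111,106], [111,108,110,105], [111,109]], [[110,105], [110,107], [110,108,111]],
     [[108,72,75,70,63,66,64,38,92], [108,110], [108,111]],
     [[38,36,39,78], [38,64,66,63,70,75,72,108], [38,92]],
     [[36,37,42,41,40,71,74,72,108], [36,38], [36,39,78]],
     [[100,2,1,0,31,34,32,37,36], [100,102], [100,103]],
     [[39,24,26,21,20,10,8,9,4,7,2,100], [39,36], [39,78]],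
     [[75,70,63,66,64,38], [75,72,108], [75,73,71,40,41,42,37,36]],
     [[70,63,66,64,38], [70,69,74,72,108], [70,75]], [[72,74,69,70], [72,75], [72,108]],
     [[74,69,70], [74,71,73,75], [74,72]], [[69,68,73,75], [69,70], [69,74]],
     [[73,68,69], [73,71,74], [73,75]], [[71,40,41,42,37,36], [71,73], [71,74]],
     [[68,51,43,45,40,71], [68,69], [68,73]], [[45,40,71], [45,43,51,68], [45,47,42,37,36]],
     [[40,41,42,37,36], [40,45], [40,71]], [[42,37,36], [42,41,40], [42,47,45]],
     [[41,40], [41,42], [41,46,43,45]], [[43,45], [43,46,41], [43,51,68]],
     [[47,42], [47,44,46,41], [47,45]], [[46,41], [46,43], [46,44,47]],
     [[44,46], [44,47], [44,49,48,51,43]], [[51,43], [51,48,49,44], [51,68]],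
     [[48,49,44], [48,50,60,65,63,70], [48,51]], [[65,60,50,48], [65,63,70], [65,67,64,38]],
     [[63,65], [63,66,64,38], [63,70]], [[64,38], [64,66,63], [64,67,65]],
     [[66,61,60,65], [66,63], [66,64]], [[60,50,48], [60,61,66], [60,65]],
     [[67,62,61,60], [67,64], [67,65]], [[61,60], [61,62,67], [61,66]],
     [[62,55,57,52,50,48], [62,61], [62,67]], [[50,48], [50,52,57,55,62], [50,60]],
     [[49,44], [49,48], [49,54,53,52,50]], [[57,52,50], [57,55,62], [57,59,54,49]],
     [[52,50], [52,53,54,49], [52,57]], [[55,57], [55,58,53,52], [55,62]],
     [[54,49], [54,53,52], [54,59,57]], [[53,52], [53,54], [53,58,55]],
     [[59,54], [59,56,58,53], [59,57]], [[58,53], [58,55], [58,56,59]],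
     [[37,32,34,31,0,1,2,100], [37,36], [37,42]], [[56,16,18,15,22,27,24,39], [56,58], [56,59]],
     [[34,29,30,23,26,24,39], [34,31,0,1,2,100], [34,32,37]],
     [[32,34], [32,35,30,23,26,24,39], [32,37]], [[30,23,26,24,39], [30,29,34], [30,35,32]],
     [[35,30], [35,32], [35,33,31,34]], [[29,28,33,35], [29,30], [29,34]],
     [[33,28,29], [33,31,34], [33,35]], [[31,0,1,2,100], [31,33], [31,34]],
     [[28,11,3,5,0,31], [28,29], [28,33]], [[0,1,2,100], [0,5,3,11,28], [0,31]],
     [[5,0], [5,3,11,28], [5,7,2,100]], [[2,1,0], [2,7,5], [2,100]], [[1,0], [1,2], [1,6,3,5]],
     [[3,5], [3,6,1], [3,11,28]], [[7,2], [7,4,6,1], [7,5]], [[6,1], [6,3], [6,4,7]],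
     [[11,3], [11,8,9,4,6], [11,28]], [[4,6], [4,7], [4,9,8,11]],
     [[9,4], [9,8,11], [9,14,19,16,56]], [[8,9], [8,10,20,25,23,30], [8,11]],
     [[26,21,20,10,8], [26,23,30], [26,24,39]], [[23,25,20,10,8], [23,26], [23,30]],
     [[24,26], [24,27,25,23], [24,39]], [[27,22,21,26], [27,24], [27,25,23]],
     [[25,20,10,8], [25,23], [25,27]], [[21,20,25], [21,22,27], [21,26]],
     [[20,10,8], [20,21], [20,25]], [[22,15,18,16,56], [22,21], [22,27]],
     [[10,8], [10,12,13,14,9], [10,20]], [[12,10], [12,13,14,9], [12,17,15,22]],
     [[13,12], [13,14,9], [13,18,15,22]], [[18,13], [18,15,22], [18,16,56]],
     [[15,17,12], [15,18], [15,22]], [[14,9], [14,13], [14,19,16,18]],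
     [[16,18], [16,19,14], [16,56]], [[19,14], [19,16], [19,17,12]], [[17,12], [17,15], [17,19]]]"

text \<open>The initial vertices 103, 96 and 99 are the neighbors of 101, so that 101 can be added
  at once by three single edges.\<close>

lemma links:
  "link 103 96 [[98,91,93,88,86], [100,102,97], [101]]"
  "link 103 99 [[98,97,96,86,84,87,104,105,106], [100,102], [101]]"
  "link 96 99 [[86,84,87,104,105,106], [97,102], [101]]"
  by (simp_all add: nbrs_simps avoids_def edge_disjoint_def doubleton_eq_iff)

lemma fan_order_fans: "fan_order [103, 96, 99] fans"
  by (simp add: fans_def nbrs_simps avoids_def edge_disjoint_def doubleton_eq_iff)

lemma fans_cover: "{..<112} \<subseteq> {103, 96, 99} \<union> set (map (hd \<circ> hd) fans)"
proof -
  have "list_all (\<lambda>v. v \<in> {103, 96, 99} \<union> set (map (hd \<circ> hd) fans)) [0..<112]"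
    by (simp add: upt_112 fans_def)
  then show ?thesis by (auto simp: list_all_iff)
qed

section \<open>Survival of paths under two deletions\<close>

lemma avoids_iff: "avoids p q \<longleftrightarrow> set p \<inter> set q = {}"
  by (auto simp: avoids_def list_all_iff)

lemma edge_disjoint_iff: "edge_disjoint p q \<longleftrightarrow> set (walk_edges p) \<inter> set (walk_edges q) = {}"
  by (auto simp: edge_disjoint_def list_all_iff)

lemma walk_edges_subset: "walk p \<Longrightarrow> set (walk_edges p) \<subseteq> explicit_edges"
  by (induction p rule: walk.induct) (simp_all add: mem_nbrs_iff)

lemma walk_edges_vertices: "e \<in> set (walk_edges p) \<Longrightarrow> e \<subseteq> set p"
  by (induction p rule: walk_edges.induct) auto

lemma walk_edges_rtrancl:
  "set (walk_edges (u # p)) \<subseteq> E \<Longrightarrow> (u, last (u # p)) \<in> {(x, y). {x, y} \<in> E}\<^sup>*"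
proof (induction p arbitrary: u)
  case (Cons v p)
  then have "(u, v) \<in> {(x, y). {x, y} \<in> E}" "(v, last (v # p)) \<in> {(x, y). {x, y} \<in> E}\<^sup>*"
    by auto
  from converse_rtrancl_into_rtrancl[OF this] show ?case by simp
qed simp

text \<open>Pigeonhole principle, applied to the vertex sets of paths when vertices are deleted and
  to their edge sets when edges are deleted.\<close>

lemma one_of_three_avoids:
  assumes "A \<inter> B = {}" "A \<inter> C = {}" "B \<inter> C = {}" "finite X" "card X < 3"
  shows "A \<inter> X = {} \<or> B \<inter> X = {} \<or> C \<inter> X = {}"
proof (rule ccontr)
  assume "\<not> ?thesis"
  then obtain a b c where abc: "a \<in> A \<inter> X" "b \<in> B \<inter> X" "c \<in> C \<inter> X" by blast
  then have "card {a, b, c} = 3" using assms(1-3) by (auto simp: card_insert_if)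
  moreover have "{a, b, c} \<subseteq> X" using abc by blast
  ultimately show False using card_mono[OF assms(4), of "{a, b, c}"] assms(5) by simp
qed

text \<open>\<open>W\<close> stands for the surviving vertices and \<open>R\<close> for reachability
  after the deletion. Keeping both abstract lets one induction serve both kinds of deletion, with
  \<open>W = UNIV\<close> for edges. The invariant is that the survivors among the vertices added so
  far reach each other.\<close>

lemma fan_order_connected:
  assumes order: "fan_order K pss"
    and base: "\<And>a b. a \<in> set K \<inter> W \<Longrightarrow> b \<in> set K \<inter> W \<Longrightarrow> (a, b) \<in> R"
    and step: "\<And>K ps. fan K ps \<Longrightarrow> hd (hd ps) \<in> W \<Longrightarrow> \<exists>b\<in>set K \<inter> W. (hd (hd ps), b) \<in> R"
    and R: "sym R" "trans R" "refl R"
    and ab: "a \<in> (set K \<union> set (map (hd \<circ> hd) pss)) \<inter> W" "b \<in> (set K \<union> set (map (hd \<circ> hd) pss)) \<inter> W"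
  shows "(a, b) \<in> R"
  using order base ab
proof (induction pss arbitrary: K)
  case (Cons ps pss)
  let ?v = "hd (hd ps)"
  have fan: "fan K ps" "fan_order (?v # K) pss"
    using Cons.prems(1) by simp_all
  have v: "(?v, c) \<in> R \<and> (c, ?v) \<in> R" if "?v \<in> W" "c \<in> set K \<inter> W" for c
  proof -
    obtain b where "b \<in> set K \<inter> W" "(?v, b) \<in> R" using step[OF fan(1) \<open>?v \<in> W\<close>] by blast
    then have "(?v, c) \<in> R" using Cons.prems(2) that(2) R(2) by (blast dest: transD)
    then show ?thesis using R(1) by (blast dest: symD)
  qed
  have "(c, d) \<in> R" if "c \<in> set (?v # K) \<inter> W" "d \<in> set (?v # K) \<inter> W" for c d
    using that v Cons.prems(2) R(3) by (auto dest: reflD)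
  then show ?case
    using Cons.IH[OF fan(2)] Cons.prems(3,4) by simp
qed simp

lemma connected_of_fans:
  fixes E :: "nat set set"
  defines "R \<equiv> {(x, y). {x, y} \<in> E}\<^sup>*"
  assumes step: "\<And>K ps. fan K ps \<Longrightarrow> hd (hd ps) \<in> W \<Longrightarrow> \<exists>b\<in>set K \<inter> W. (hd (hd ps), b) \<in> R"
    and link: "\<And>a b ps. link a b ps \<Longrightarrow> a \<in> W \<Longrightarrow> b \<in> W \<Longrightarrow> (a, b) \<in> R"
    and uv: "u < 112" "v < 112" "u \<in> W" "v \<in> W"
  shows "(u, v) \<in> R"
proof -
  have R: "sym R" "trans R" "refl R"
    unfolding R_def
    by (intro sym_rtrancl symI, simp add: insert_commute) (simp_all add: trans_rtrancl refl_rtrancl)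
  have base: "(a, b) \<in> R" if "a \<in> set [103, 96, 99] \<inter> W" "b \<in> set [103, 96, 99] \<inter> W" for a b
    using that link[OF links(1)] link[OF links(2)] link[OF links(3)] R(1,3)
    by (auto dest: reflD symD)
  have mem: "x \<in> (set [103, 96, 99] \<union> set (map (hd \<circ> hd) fans)) \<inter> W" if "x < 112" "x \<in> W" for x
    using subsetD[OF fans_cover, of x] that by simp
  show ?thesis
    by (rule fan_order_connected[where W = W, OF fan_order_fans base step R mem[OF uv(1,3)] mem[OF uv(2,4)]])
qed

lemma fanE:
  assumes "fan K ps"
  obtains v p q r where "ps = [v # p, v # q, v # r]"
    "\<And>s. s \<in> {p, q, r} \<Longrightarrow> walk (v # s) \<and> s \<noteq> [] \<and> last s \<in> set K"
    "set p \<inter> set q = {}" "set p \<inter> set r = {}" "set q \<inter> set r = {}"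
    "set (walk_edges (v # p)) \<inter> set (walk_edges (v # q)) = {}"
    "set (walk_edges (v # p)) \<inter> set (walk_edges (v # r)) = {}"
    "set (walk_edges (v # q)) \<inter> set (walk_edges (v # r)) = {}"
  using assms by (cases "(K, ps)" rule: fan.cases) (auto simp: avoids_iff edge_disjoint_iff)

lemma linkE:
  assumes "link a b ps"
  obtains p q r where "\<And>s. s \<in> {p, q, r} \<Longrightarrow> walk (a # s @ [b])"
    "set p \<inter> set q = {}" "set p \<inter> set r = {}" "set q \<inter> set r = {}"
    "set (walk_edges (a # p @ [b])) \<inter> set (walk_edges (a # q @ [b])) = {}"
    "set (walk_edges (a # p @ [b])) \<inter> set (walk_edges (a # r @ [b])) = {}"
    "set (walk_edges (a # q @ [b])) \<inter> set (walk_edges (a # r @ [b])) = {}"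
  using assms by (cases "(a, b, ps)" rule: link.cases) (auto simp: avoids_iff edge_disjoint_iff)

lemma connected_delete_verts:
  assumes "X \<subseteq> verts explicit_graph" "card X < 3"
  shows "connected_graph (delete_verts explicit_graph X)"
proof -
  have fin: "finite X" using assms(1) by (simp add: finite_subset)
  let ?E = "{e \<in> explicit_edges. e \<inter> X = {}}"
  let ?R = "{(x, y). {x, y} \<in> ?E}\<^sup>*"
  have walk: "(u, last (u # p)) \<in> ?R" if "walk (u # p)" "set (u # p) \<inter> X = {}" for u p
  proof (rule walk_edges_rtrancl)
    have "e \<inter> X = {}" if "e \<in> set (walk_edges (u # p))" for e
      using walk_edges_vertices[OF that] \<open>set (u # p) \<inter> X = {}\<close> by blast
    then show "set (walk_edges (u # p)) \<subseteq> ?E"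
      using walk_edges_subset[OF \<open>walk (u # p)\<close>] by blast
  qed
  have fans: "\<exists>b\<in>set K \<inter> - X. (hd (hd ps), b) \<in> ?R" if fan: "fan K ps" "hd (hd ps) \<in> - X" for K ps
  proof -
    obtain v p q r where ps: "ps = [v # p, v # q, v # r]"
      and walks: "\<And>s. s \<in> {p, q, r} \<Longrightarrow> walk (v # s) \<and> s \<noteq> [] \<and> last s \<in> set K"
      and disj: "set p \<inter> set q = {}" "set p \<inter> set r = {}" "set q \<inter> set r = {}"
      by (rule fanE[OF fan(1)]) blast
    obtain s where s: "s \<in> {p, q, r}" "set s \<inter> X = {}"
      using one_of_three_avoids[OF disj fin assms(2)] by blast
    have "(v, last (v # s)) \<in> ?R"
      using walk[of v s] walks[OF s(1)] s(2) fan(2) ps by simp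
    moreover have "last s \<notin> X"
      using walks[OF s(1)] s(2) last_in_set[of s] by blast
    ultimately show ?thesis using walks[OF s(1)] ps by (intro bexI[of _ "last s"]) auto
  qed
  have links: "(a, b) \<in> ?R" if link: "link a b ps" "a \<in> - X" "b \<in> - X" for a b ps
  proof -
    obtain p q r where walks: "\<And>s. s \<in> {p, q, r} \<Longrightarrow> walk (a # s @ [b])"
      and disj: "set p \<inter> set q = {}" "set p \<inter> set r = {}" "set q \<inter> set r = {}"
      by (rule linkE[OF link(1)]) blast
    obtain s where s: "s \<in> {p, q, r}" "set s \<inter> X = {}"
      using one_of_three_avoids[OF disj fin assms(2)] by blast
    show ?thesis
      using walk[of a "s @ [b]"] walks[OF s(1)] s(2) link(2,3) by simp
  qed
  have "(u, v) \<in> ?R" if "u \<in> verts explicit_graph - X" "v \<in> verts explicit_graph - X" for u v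
    using connected_of_fans[of "- X" ?E u v, OF fans links] that by simp
  moreover have "verts explicit_graph - X \<noteq> {}"
  proof
    assume "verts explicit_graph - X = {}"
    then have "card (verts explicit_graph) \<le> card X" by (intro card_mono fin) auto
    then show False using assms(2) by simp
  qed
  ultimately show ?thesis
    by (simp add: connected_graph_def delete_verts_def reachable_def)
qed

lemma connected_delete_edges:
  assumes "F \<subseteq> edges explicit_graph" "card F < 3"
  shows "connected_graph (delete_edges explicit_graph F)"
proof -
  have "finite explicit_edges"
    using card_explicit_edges card.infinite by fastforce
  then have fin: "finite F" using assms(1) by (simp add: finite_subset)
  let ?E = "explicit_edges - F"
  let ?R = "{(x, y). {x, y} \<in> ?E}\<^sup>*"
  have walk: "(u, last (u # p)) \<in> ?R" if "walk (u # p)" "set (walk_edges (u # p)) \<inter> F = {}" for u p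
    by (rule walk_edges_rtrancl) (use walk_edges_subset[OF that(1)] that(2) in blast)
  have fans: "\<exists>b\<in>set K \<inter> UNIV. (hd (hd ps), b) \<in> ?R" if fan: "fan K ps" for K ps
  proof -
    obtain v p q r where ps: "ps = [v # p, v # q, v # r]"
      and walks: "\<And>s. s \<in> {p, q, r} \<Longrightarrow> walk (v # s) \<and> s \<noteq> [] \<and> last s \<in> set K"
      and disj: "set (walk_edges (v # p)) \<inter> set (walk_edges (v # q)) = {}"
        "set (walk_edges (v # p)) \<inter> set (walk_edges (v # r)) = {}"
        "set (walk_edges (v # q)) \<inter> set (walk_edges (v # r)) = {}"
      by (rule fanE[OF fan]) blast
    obtain s where s: "s \<in> {p, q, r}" "set (walk_edges (v # s)) \<inter> F = {}"
      using one_of_three_avoids[OF disj fin assms(2)] by blast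
    have "(v, last (v # s)) \<in> ?R"
      using walk[of v s] walks[OF s(1)] s(2) by blast
    then show ?thesis using walks[OF s(1)] ps by (intro bexI[of _ "last s"]) auto
  qed
  have links: "(a, b) \<in> ?R" if link: "link a b ps" for a b ps
  proof -
    obtain p q r where walks: "\<And>s. s \<in> {p, q, r} \<Longrightarrow> walk (a # s @ [b])"
      and disj: "set (walk_edges (a # p @ [b])) \<inter> set (walk_edges (a # q @ [b])) = {}"
        "set (walk_edges (a # p @ [b])) \<inter> set (walk_edges (a # r @ [b])) = {}"
        "set (walk_edges (a # q @ [b])) \<inter> set (walk_edges (a # r @ [b])) = {}"
      by (rule linkE[OF link]) blast
    obtain s where s: "s \<in> {p, q, r}" "set (walk_edges (a # s @ [b])) \<inter> F = {}"
      using one_of_three_avoids[OF disj fin assms(2)] by blast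
    then show ?thesis
      using walk[OF walks[OF s(1)] s(2)] by simp
  qed
  have "(u, v) \<in> ?R" if "u \<in> verts explicit_graph" "v \<in> verts explicit_graph" for u v
    using connected_of_fans[of UNIV ?E u v, OF fans links] that by simp
  then show ?thesis
    by (simp add: connected_graph_def delete_edges_def reachable_def)
qed

text \<open>Gives the upper bound 3 for both connectivities, as three deletions suffice to isolate
  the vertex 0.\<close>

lemma not_connected_isolated:
  assumes "u \<in> verts H" "v \<in> verts H" "u \<noteq> v" "\<And>w. {u, w} \<notin> edges H"
  shows "\<not> connected_graph H"
proof
  assume "connected_graph H"
  then have "(u, v) \<in> {(x, y). {x, y} \<in> edges H}\<^sup>*"
    using assms(1,2) by (auto simp: connected_graph_def reachable_def)
  then show False
    using assms(3,4) by (auto elim: converse_rtranclE)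
qed

lemma edge_connected_explicit_graph: "edge_connected k explicit_graph \<longleftrightarrow> k \<le> 3"
proof
  assume k: "edge_connected k explicit_graph"
  show "k \<le> 3"
  proof (rule ccontr)
    assume "\<not> k \<le> 3"
    then have "card (incident explicit_graph 0) < k" by (simp add: card_incident_explicit_graph)
    then have "connected_graph (delete_edges explicit_graph (incident explicit_graph 0))"
      using k unfolding edge_connected_def by (auto simp: incident_def)
    moreover have "\<not> connected_graph (delete_edges explicit_graph (incident explicit_graph 0))"
      by (rule not_connected_isolated[of 0 _ 1]) (auto simp: delete_edges_def incident_def)
    ultimately show False by contradiction
  qed
next
  assume "k \<le> 3"
  then show "edge_connected k explicit_graph"
    unfolding edge_connected_def using connected_delete_edges by auto
qed

lemma vertex_connected_explicit_graph: "vertex_connected k explicit_graph \<longleftrightarrow> k \<le> 3"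
proof
  assume k: "vertex_connected k explicit_graph"
  show "k \<le> 3"
  proof (rule ccontr)
    assume "\<not> k \<le> 3"
    \<comment> \<open>These are the neighbors of 0; the vertex 2 remains as one that 0 can no longer
      reach.\<close>
    then have "card {1, 5, 31 :: nat} < k" by simp
    then have "connected_graph (delete_verts explicit_graph {1, 5, 31})"
      using k unfolding vertex_connected_def by auto
    moreover have "\<not> connected_graph (delete_verts explicit_graph {1, 5, 31})"
    proof (rule not_connected_isolated[of 0 _ 2])
      fix w
      show "{0, w} \<notin> edges (delete_verts explicit_graph {1, 5, 31})"
        using mem_nbrs_iff[of w 0] by (auto simp: delete_verts_def nbrs_eqs)
    qed (simp_all add: delete_verts_def)
    ultimately show False by contradiction
  qed
next
  assume "k \<le> 3"
  then show "vertex_connected k explicit_graph"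
    unfolding vertex_connected_def using connected_delete_verts by auto
qed

lemma components_connected: "connected_graph H \<Longrightarrow> components H = {verts H}"
proof -
  assume "connected_graph H"
  then have "verts H \<noteq> {}" "reachable H `` {u} = verts H" if "u \<in> verts H" for u
    using that by (auto simp: connected_graph_def reachable_def)
  then show ?thesis
    using \<open>connected_graph H\<close> by (auto simp: components_def quotient_def connected_graph_def)
qed

lemma connected_explicit_graph: "connected_graph explicit_graph"
  using connected_delete_edges[of "{}"] by (simp add: delete_edges_def explicit_graph_def)

lemma bridgeless_explicit_graph: "bridgeless explicit_graph"
proof -
  have "components (delete_edges explicit_graph {e}) = {verts (delete_edges explicit_graph {e})}" if "e \<in> edges explicit_graph" for e
    using that by (intro components_connected connected_delete_edges) auto
  then show ?thesis
    by (auto simp: bridgeless_def is_bridge_def components_connected[OF connected_explicit_graph])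
qed

lemma edge_connectivity_explicit_graph: "edge_connectivity explicit_graph = 3"
  unfolding edge_connectivity_def edge_connected_explicit_graph by (rule cSup_eq_maximum) auto

lemma vertex_connectivity_explicit_graph: "vertex_connectivity explicit_graph = 3"
  unfolding vertex_connectivity_def vertex_connected_explicit_graph by (rule cSup_eq_maximum) auto

section \<open>From normal colorings to Petersen colorings\<close>

lemma vertex_of_petersen: "s \<in> verts petersen \<longleftrightarrow> s \<subseteq> {..<5} \<and> card s = 2"
proof -
  have "{0, 1, 2, 3, 4} = {..<5 :: nat}" by auto
  then show ?thesis by (simp add: petersen_def Let_def)
qed

lemma edge_of_petersen:
  "e \<in> edges petersen \<longleftrightarrow>
    (\<exists>s t. e = {s, t} \<and> s \<in> verts petersen \<and> t \<in> verts petersen \<and> s \<inter> t = {})"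
  by (auto simp: petersen_def Let_def)

text \<open>An edge \<open>e\<close> at \<open>v\<close> goes to the Petersen edge at
  \<open>S v\<close> whose two ends together omit exactly the color \<open>c e\<close>. This does
  not depend on the chosen end of \<open>e\<close>: for a rich edge the second end of the image is
  the set \<open>S u\<close> of the other end \<open>u\<close>, and for a poor edge
  \<open>S u = S v\<close>. In the poor case the image is thus not the pair of the two
  complements.\<close>

lemma normal_5_edge_coloring_imp_petersen_coloring:
  assumes simple: "simple_graph G" and cubic: "cubic G" and normal: "normal_5_edge_coloring G c"
  shows "has_petersen_coloring G"
proof -
  define C where "C v = c ` incident G v" for v
  define S where "S v = {..<5} - C v" for v
  define \<phi> where "\<phi> e = (let v = SOME v. v \<in> e in {S v, {..<5} - {c e} - S v})" for e
  have less: "c e < 5" if "e \<in> edges G" for e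
    using normal that by (simp add: normal_5_edge_coloring_def proper_edge_coloring_def)
  have C5: "C v \<subseteq> {..<5}" for v
    using less by (auto simp: C_def incident_def)
  have inj: "inj_on c (incident G v)" for v
  proof (rule inj_onI)
    fix e f assume "e \<in> incident G v" "f \<in> incident G v" "c e = c f"
    then show "e = f"
      using normal by (auto simp: normal_5_edge_coloring_def proper_edge_coloring_def incident_def)
  qed
  have card_C: "card (C v) = 3" if "v \<in> verts G" for v
    using cubic that by (simp add: C_def card_image[OF inj] cubic_def)
  have card_S: "card (S v) = 2" if "v \<in> verts G" for v
    using card_C[OF that] C5[of v] by (simp add: S_def card_Diff_subset finite_subset)
  have \<phi>: "\<phi> e = {S v, {..<5} - {c e} - S v}" if "e \<in> edges G" "v \<in> e" for e v
  proof -
    define u where "u = (SOME v. v \<in> e)"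
    have "u \<in> e" unfolding u_def using that(2) by (rule someI)
    have \<phi>u: "\<phi> e = {S u, {..<5} - {c e} - S u}"
      by (simp add: \<phi>_def u_def Let_def)
    show ?thesis
    proof (cases "u = v")
      case False
      have e: "e \<subseteq> verts G" "card e = 2"
        using simple that(1) by (auto simp: simple_graph_def)
      then have uv: "e = {u, v}"
        using \<open>u \<in> e\<close> \<open>v \<in> e\<close> False by (auto simp: card_2_iff)
      have V: "u \<in> verts G" "v \<in> verts G" using e(1) uv by auto
      have ce: "c e \<in> C u" "c e \<in> C v"
        using that(1) uv by (auto simp: C_def incident_def)
      have around: "colors_around G c e = C u \<union> C v"
        by (auto simp: colors_around_def C_def uv)
      have fin: "finite (C u)" "finite (C v)"
        using C5 by (auto intro: finite_subset)
      have "poor G c e \<or> rich G c e"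
        using normal that(1) by (simp add: normal_5_edge_coloring_def)
      then consider "card (C u \<union> C v) = 3" | "card (C u \<union> C v) = 5"
        unfolding poor_def rich_def around by blast
      then show ?thesis
      proof cases
        case 1
        have "C u = C u \<union> C v"
          by (rule card_subset_eq) (use 1 card_C V fin in simp_all)
        moreover have "C v = C u \<union> C v"
          by (rule card_subset_eq) (use 1 card_C V fin in simp_all)
        ultimately have "S u = S v" by (simp add: S_def)
        with \<phi>u show ?thesis by simp
      next
        case 2
        have "C u \<union> C v = {..<5}"
          by (rule card_subset_eq) (use 2 C5 in simp_all)
        moreover have "C u \<inter> C v = {c e}"
        proof -
          have "card (C u \<inter> C v) = 1"
            using card_Un_Int[OF fin] 2 card_C V by simp
          then obtain x where x: "C u \<inter> C v = {x}" by (rule card_1_singletonE)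
          have "c e \<in> {x}" unfolding x[symmetric] using ce by simp
          with x show ?thesis by simp
        qed
        ultimately have "{..<5} - {c e} - S u = S v" "{..<5} - {c e} - S v = S u"
          unfolding S_def by blast+
        with \<phi>u show ?thesis by (simp add: insert_commute)
      qed
    qed (use \<phi>u in simp)
  qed
  have S_vertex: "S v \<in> verts petersen" if "v \<in> verts G" for v
    using card_S[OF that] by (auto simp: vertex_of_petersen S_def)
  have T_vertex: "{..<5} - {c e} - S v \<in> verts petersen" if "e \<in> incident G v" "v \<in> verts G" for e v
  proof -
    have "c e \<notin> S v" "c e < 5"
      using that less by (auto simp: S_def C_def incident_def)
    then have "card ({..<5} - {c e} - S v) = 2"
      using card_S[OF that(2)] by (subst card_Diff_subset) (auto simp: S_def)
    then show ?thesis by (auto simp: vertex_of_petersen)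
  qed
  have \<phi>_edge: "\<phi> e \<in> edges petersen" if "e \<in> incident G v" "v \<in> verts G" for e v
    unfolding edge_of_petersen using \<phi>[of e v] S_vertex T_vertex that
    by (intro exI[of _ "S v"] exI[of _ "{..<5} - {c e} - S v"]) (auto simp: incident_def)
  have "\<phi> ` edges G \<subseteq> edges petersen"
  proof safe
    fix e assume e: "e \<in> edges G"
    then obtain v where "v \<in> e" "v \<in> verts G"
      using simple by (force simp: simple_graph_def card_2_iff)
    then show "\<phi> e \<in> edges petersen" using e by (intro \<phi>_edge[of e v]) (auto simp: incident_def)
  qed
  moreover have "bij_betw \<phi> (incident G v) (incident petersen (S v))" if v: "v \<in> verts G" for v
  proof (rule bij_betw_imageI[OF inj_onI equalityI[OF subsetI subsetI]])
    fix e f assume ef: "e \<in> incident G v" "f \<in> incident G v" "\<phi> e = \<phi> f"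
    have notin: "c e \<in> C v" "c f \<in> C v" using ef by (auto simp: C_def)
    have "S v \<noteq> {}" using card_S[OF v] by auto
    then have "{..<5} - {c e} - S v = {..<5} - {c f} - S v"
      using ef \<phi>[of e v] \<phi>[of f v] by (auto simp: incident_def doubleton_eq_iff)
    then have "c e = c f"
      using notin C5[of v] by (auto simp: S_def)
    then show "e = f" using inj ef by (auto dest: inj_onD)
  next
    fix x assume "x \<in> \<phi> ` incident G v"
    then show "x \<in> incident petersen (S v)"
      using \<phi>_edge \<phi> v by (auto simp: incident_def)
  next
    fix x assume x: "x \<in> incident petersen (S v)"
    then obtain s t where st: "x = {s, t}" "s \<in> verts petersen" "t \<in> verts petersen" "s \<inter> t = {}"
      unfolding incident_def edge_of_petersen by blast
    have "S v = s \<or> S v = t" using x st(1) by (simp add: incident_def)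
    then have "\<exists>t. x = {S v, t} \<and> t \<in> verts petersen \<and> S v \<inter> t = {}"
    proof
      assume "S v = s"
      then show ?thesis using st by (intro exI[of _ t]) simp
    next
      assume "S v = t"
      then show ?thesis using st by (intro exI[of _ s]) (simp add: insert_commute Int_commute)
    qed
    then obtain t where t: "x = {S v, t}" "t \<in> verts petersen" "S v \<inter> t = {}"
      by blast
    have tC: "t \<subseteq> C v" "card t = 2"
      using t C5[of v] by (auto simp: vertex_of_petersen S_def)
    \<comment> \<open>The neighbor \<open>t\<close> of \<open>S v\<close> uses up two of the three
      colors at \<open>v\<close>; the edge at \<open>v\<close> with the third color is the
      preimage.\<close>
    then have "card (C v - t) = 1"
      using card_C[OF v] by (subst card_Diff_subset) (auto intro: card_ge_0_finite)
    then obtain a where a: "C v - t = {a}" by (auto simp: card_1_singleton_iff)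
    have "a \<in> C v - t" by (simp add: a)
    then obtain e where e: "e \<in> incident G v" "c e = a" unfolding C_def by blast
    have "{..<5} - {c e} - S v = t"
      using a e tC C5[of v] by (auto simp: S_def)
    then have "\<phi> e = x"
      using \<phi>[of e v] e t by (simp add: incident_def)
    then show "x \<in> \<phi> ` incident G v" using e by auto
  qed
  ultimately have "is_H_coloring petersen G \<phi>"
    unfolding is_H_coloring_def using S_vertex by blast
  then show ?thesis unfolding has_petersen_coloring_def by blast
qed

section \<open>Labels of gadgets and blocks\<close>

text \<open>With constructors as names, equality of Petersen edges is decided by
  \<open>label.distinct\<close> instead of comparing sets of sets.\<close>

datatype label = L0 | L1 | L2 | L3 | L4 | L5 | L6 | L7 | L8 | L9 | L10 | L11 | L12 | L13 | L14

primrec petersen_edge :: "label \<Rightarrow> nat set set" where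
  "petersen_edge L0 = {{0, 1}, {2, 3}}"
| "petersen_edge L1 = {{0, 1}, {2, 4}}"
| "petersen_edge L2 = {{0, 1}, {3, 4}}"
| "petersen_edge L3 = {{0, 2}, {1, 3}}"
| "petersen_edge L4 = {{0, 2}, {1, 4}}"
| "petersen_edge L5 = {{0, 2}, {3, 4}}"
| "petersen_edge L6 = {{0, 3}, {1, 2}}"
| "petersen_edge L7 = {{0, 3}, {1, 4}}"
| "petersen_edge L8 = {{0, 3}, {2, 4}}"
| "petersen_edge L9 = {{0, 4}, {1, 2}}"
| "petersen_edge L10 = {{0, 4}, {1, 3}}"
| "petersen_edge L11 = {{0, 4}, {2, 3}}"
| "petersen_edge L12 = {{1, 2}, {3, 4}}"
| "petersen_edge L13 = {{1, 3}, {2, 4}}"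
| "petersen_edge L14 = {{1, 4}, {2, 3}}"

text \<open>For both ends of an edge of the Petersen graph, \<open>row\<close> contains the other two edges at this end,
  in both orders.\<close>

primrec row :: "label \<Rightarrow> (label \<times> label) list" where
  "row L0 = [(L1, L2), (L2, L1), (L11, L14), (L14, L11)]"
| "row L1 = [(L0, L2), (L2, L0), (L8, L13), (L13, L8)]"
| "row L2 = [(L0, L1), (L1, L0), (L5, L12), (L12, L5)]"
| "row L3 = [(L4, L5), (L5, L4), (L10, L13), (L13, L10)]"
| "row L4 = [(L3, L5), (L5, L3), (L7, L14), (L14, L7)]"
| "row L5 = [(L2, L12), (L3, L4), (L4, L3), (L12, L2)]"
| "row L6 = [(L7, L8), (L8, L7), (L9, L12), (L12, L9)]"
| "row L7 = [(L4, L14), (L6, L8), (L8, L6), (L14, L4)]"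
| "row L8 = [(L1, L13), (L6, L7), (L7, L6), (L13, L1)]"
| "row L9 = [(L6, L12), (L10, L11), (L11, L10), (L12, L6)]"
| "row L10 = [(L3, L13), (L9, L11), (L11, L9), (L13, L3)]"
| "row L11 = [(L0, L14), (L9, L10), (L10, L9), (L14, L0)]"
| "row L12 = [(L2, L5), (L5, L2), (L6, L9), (L9, L6)]"
| "row L13 = [(L1, L8), (L3, L10), (L8, L1), (L10, L3)]"
| "row L14 = [(L0, L11), (L4, L7), (L7, L4), (L11, L0)]"

definition triad :: "label \<Rightarrow> label \<Rightarrow> label \<Rightarrow> bool" where
  "triad a b c \<longleftrightarrow> (b, c) \<in> set (row a)"

abbreviation labels :: "label list" where
  "labels \<equiv> [L0, L1, L2, L3, L4, L5, L6, L7, L8, L9, L10, L11, L12, L13, L14]"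

text \<open>Used in two ways: \<open>lookup b (row a)\<close> is nonempty iff the labels are
  adjacent, and it yields the third label at a vertex where \<open>a\<close> and \<open>b\<close>
  are known.\<close>

fun lookup :: "'a \<Rightarrow> ('a \<times> 'b) list \<Rightarrow> 'b list" where
  "lookup a [] = []"
| "lookup a ((b, c) # xs) = (if a = b then c # lookup a xs else lookup a xs)"

lemma set_lookup: "set (lookup a xs) = {b. (a, b) \<in> set xs}"
  by (induction a xs rule: lookup.induct) auto

lemma list_all_pairD: "list_all (\<lambda>(a, b). P a b) xs \<Longrightarrow> (a, b) \<in> set xs \<Longrightarrow> P a b"
  by (auto simp: list_all_iff)

lemma list_all_lookupD: "list_all P (lookup a xs) \<Longrightarrow> (a, b) \<in> set xs \<Longrightarrow> P b"
  by (simp add: list_all_iff set_lookup)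

text \<open>Called for distinct edges without a common end. Since the Petersen graph has no 4-cycle,
  at most one edge \<open>t\<close> joins them, and the search may stop at the first. If there is
  none, the list is empty: such a pair cannot occur at the ports 0 and 2.\<close>

fun detour :: "label \<Rightarrow> label \<Rightarrow> (label \<times> label) list \<Rightarrow> (label \<times> label) list" where
  "detour a b [] = []"
| "detour a b ((d, t) # xs) =
     (case lookup t (row b) of [] \<Rightarrow> detour a b xs | c # cs \<Rightarrow> [(b, a), (c, d)])"

text \<open>If the dangling edges at the vertices 0 and 2 of a gadget (the Petersen graph minus two
  adjacent vertices, see \<open>gadget_at\<close> below) carry the labels a and b, then the list contains the
  possible pairs of labels at the vertices 3 and 4. Either the gadget acts like two wires, from 0 to 4 and
  from 2 to 3, or the four labels are the neighbors of the label t of \<open>detour\<close>.\<close>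

definition gadget_ports :: "label \<Rightarrow> label \<Rightarrow> (label \<times> label) list" where
  "gadget_ports a b = (if a = b \<or> lookup b (row a) \<noteq> [] then [(b, a)] else detour a b (row a))"

text \<open>Unlike a gadget, which passes a pair of equal labels on unchanged, a block replaces it
  by a pair of copies of an adjacent label. Different labels persist and can be exchanged only if
  they have no common end.\<close>

definition block_ports :: "label \<Rightarrow> label \<Rightarrow> (label \<times> label) list" where
  "block_ports a b =
     (if a = b then map (\<lambda>(c, d). (c, c)) (row a)
      else if lookup b (row a) = [] then [(a, b), (b, a)] else [(a, b)])"

lemmas label_eval = list.pred_inject swap_simp prod.case row.simps lookup.simps detour.simps
  gadget_ports_def block_ports_def label.distinct list.set insert_iff empty_iff prod.inject if_True if_False simp_thms
  list.case list.distinct list.map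

lemma mem_labels: "a \<in> set labels"
  by (cases a) simp_all

text \<open>Here \<open>e01\<close> is the label of the edge between the vertices 0 and 1 of the gadget, and
  \<open>x0\<close> that of the dangling edge at 0; similarly for the other names.\<close>

lemma gadget_check:
  "list_all (\<lambda>x0. list_all (\<lambda>(e01, e05). list_all (\<lambda>(e12, e16). list_all (\<lambda>(e27, x2).
   list_all (\<lambda>(e35, e57). list_all (\<lambda>e47. list_all (\<lambda>(e36, x3). list_all (\<lambda>e46. list_all (\<lambda>x4.
     (x3, x4) \<in> set (gadget_ports x0 x2))
   (lookup e46 (row e47))) (lookup e36 (row e16))) (row e35)) (lookup e57 (row e27))) (row e05))
   (row e12)) (row e01)) (row x0)) labels"
  by (simp only: label_eval)

lemma gadget:
  assumes "triad x0 e01 e05" "triad e01 e12 e16" "triad e12 e27 x2" "triad e05 e35 e57"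
    "triad e27 e57 e47" "triad e35 e36 x3" "triad e16 e36 e46" "triad e47 e46 x4"
  shows "(x3, x4) \<in> set (gadget_ports x0 x2)"
proof -
  note t = assms[unfolded triad_def]
  note list_allD[OF gadget_check mem_labels[of x0]]
  note list_all_pairD[OF this t(1)]
  note list_all_pairD[OF this t(2)]
  note list_all_pairD[OF this t(3)]
  note list_all_pairD[OF this t(4)]
  note list_all_lookupD[OF this t(5)]
  note list_all_pairD[OF this t(6)]
  note list_all_lookupD[OF this t(7)]
  note list_all_lookupD[OF this t(8)]
  then show ?thesis .
qed

text \<open>Mirrors the automorphism of the gadget that exchanges 0 with 4, 2 with 3, 1 with 6, and
  5 with 7.\<close>

lemma gadget_ports_rev_check:
  "list_all (\<lambda>a. list_all (\<lambda>b. list_all (\<lambda>(c, d). (b, a) \<in> set (gadget_ports d c)) (gadget_ports a b)) labels) labels"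
  by (simp only: label_eval)

lemma gadget_ports_rev: "(c, d) \<in> set (gadget_ports a b) \<Longrightarrow> (b, a) \<in> set (gadget_ports d c)"
  by (rule list_all_pairD[OF list_allD[OF list_allD[OF gadget_ports_rev_check mem_labels] mem_labels]])

text \<open>A block consists of a claw, with edges labelled \<open>c1\<close>, \<open>c2\<close>, \<open>c3\<close>, and four gadgets;
  \<open>x\<close>, \<open>y\<close>, \<open>z\<close>, \<open>w\<close> are the labels of its dangling edges.\<close>

lemma block_check:
  "list_all (\<lambda>c1. list_all (\<lambda>(c2, c3). list_all (\<lambda>(p, q). list_all (\<lambda>(u, v).
   list_all (\<lambda>(s, y). list_all (\<lambda>(t, z). list_all (\<lambda>(k, l). list_all (\<lambda>(h, w).
   list_all (\<lambda>x. (z, w) \<in> set (block_ports x y))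
   (lookup h (map prod.swap (gadget_ports u k)))) (gadget_ports l t)) (row c3)) (gadget_ports q s))
   (gadget_ports p v)) (row c1)) (row c2)) (row c1)) labels"
  by (simp only: label_eval)

lemma block:
  assumes "triad c1 c2 c3" "triad c2 p q" "triad c1 u v" "triad c3 k l"
    "(s, y) \<in> set (gadget_ports p v)" "(t, z) \<in> set (gadget_ports q s)"
    "(h, w) \<in> set (gadget_ports l t)" "(k, u) \<in> set (gadget_ports h x)"
  shows "(z, w) \<in> set (block_ports x y)"
proof -
  note t = assms(1-4)[unfolded triad_def]
  \<comment> \<open>The search reaches this gadget with \<open>k\<close>, \<open>u\<close> and
    \<open>h\<close> known and \<open>x\<close> wanted, so the gadget is traversed
    backwards.\<close>
  have x: "(h, x) \<in> set (map prod.swap (gadget_ports u k))"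
    using gadget_ports_rev[OF assms(8)] by force
  note list_allD[OF block_check mem_labels[of c1]]
  note list_all_pairD[OF this t(1)]
  note list_all_pairD[OF this t(2)]
  note list_all_pairD[OF this t(3)]
  note list_all_pairD[OF this assms(5)]
  note list_all_pairD[OF this assms(6)]
  note list_all_pairD[OF this t(4)]
  note list_all_pairD[OF this assms(7)]
  note list_all_lookupD[OF this x]
  then show ?thesis .
qed

lemma block_ports_sym_check:
  "list_all (\<lambda>a. list_all (\<lambda>b. list_all (\<lambda>(c, d). (a, b) \<in> set (block_ports c d)) (block_ports a b)) labels) labels"
  by (simp only: label_eval)

lemma block_ports_sym: "(c, d) \<in> set (block_ports a b) \<Longrightarrow> (a, b) \<in> set (block_ports c d)"
  by (rule list_all_pairD[OF list_allD[OF list_allD[OF block_ports_sym_check mem_labels] mem_labels]])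

text \<open>Any two of the three blocks are joined by one edge and attached to a common leaf of the
  fourth claw. Here \<open>r\<close>, \<open>s\<close>, \<open>t\<close> are the labels of the edges
  between blocks, \<open>a\<close>, \<open>b\<close>, \<open>c\<close> those of the claw, and the
  pairs \<open>d\<close>, \<open>e\<close> and \<open>f\<close>, \<open>g\<close> and
  \<open>h\<close>, \<open>i\<close> belong to the remaining edges at its leaves.\<close>

lemma centre_check:
  "list_all (\<lambda>a. list_all (\<lambda>(b, c). list_all (\<lambda>(d, e). list_all (\<lambda>(f, g). list_all (\<lambda>(r, s).
   list_all (\<lambda>(h, t). list_all (\<lambda>i. (r, t) \<notin> set (block_ports g i))
   (lookup h (row b))) (block_ports e s)) (block_ports f d)) (row c)) (row a)) (row a)) labels"
  by (simp only: label_eval)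

lemma centre:
  assumes "triad a b c" "triad a d e" "triad c f g" "triad b h i" "(r, s) \<in> set (block_ports f d)"
    "(h, t) \<in> set (block_ports e s)" "(r, t) \<in> set (block_ports g i)"
  shows False
proof -
  note t = assms(1-4)[unfolded triad_def]
  note list_allD[OF centre_check mem_labels[of a]]
  note list_all_pairD[OF this t(1)]
  note list_all_pairD[OF this t(2)]
  note list_all_pairD[OF this t(3)]
  note list_all_pairD[OF this assms(5)]
  note list_all_pairD[OF this assms(6)]
  note list_all_lookupD[OF this t(4)]
  with assms(7) show False by contradiction
qed

section \<open>Agreement of the label tables with the Kneser graph\<close>

lemma verts_petersen: "verts petersen = {{0, 1}, {0, 2}, {0, 3}, {0, 4}, {1, 2}, {1, 3}, {1, 4}, {2, 3}, {2, 4}, {3, 4}}"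
proof -
  have "s \<subseteq> {0, 1, 2, 3, 4} \<and> card s = 2 \<longleftrightarrow> (\<exists>x\<in>{0, 1, 2, 3, 4}. \<exists>y\<in>{0, 1, 2, 3, 4}. x < y \<and> s = {x, y})"
    for s :: "nat set"
  proof
    assume s: "s \<subseteq> {0, 1, 2, 3, 4} \<and> card s = 2"
    then obtain x y where xy: "s = {x, y}" "x \<noteq> y" by (auto simp: card_2_iff)
    with s have "{x, y} \<subseteq> {0, 1, 2, 3, 4}" by simp
    then show "\<exists>x\<in>{0, 1, 2, 3, 4}. \<exists>y\<in>{0, 1, 2, 3, 4}. x < y \<and> s = {x, y}"
      using xy by (cases x y rule: linorder_cases) (blast intro: insert_commute)+
  qed auto
  then have "verts petersen = {s. \<exists>x\<in>{0, 1, 2, 3, 4}. \<exists>y\<in>{0, 1, 2, 3, 4}. x < y \<and> s = {x, y}}"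
    by (simp add: petersen_def Let_def)
  also have "\<dots> = {{0, 1}, {0, 2}, {0, 3}, {0, 4}, {1, 2}, {1, 3}, {1, 4}, {2, 3}, {2, 4}, {3, 4}}"
    by (simp add: set_eq_iff)
  finally show ?thesis .
qed

lemma edges_petersen: "edges petersen \<subseteq> petersen_edge ` set labels"
proof
  fix e assume "e \<in> edges petersen"
  then obtain s t where e: "e = {s, t}" "s \<in> verts petersen" "t \<in> verts petersen" "s \<inter> t = {}"
    by (auto simp: petersen_def Let_def)
  from e(2-4) show "e \<in> petersen_edge ` set labels"
    unfolding verts_petersen e(1) by (elim insertE emptyE; simp add: doubleton_eq_iff)
qed

definition petersen_stars :: "(nat set \<times> label \<times> label \<times> label) list" where
  "petersen_stars =
    [({0, 1}, L0, L1, L2), ({0, 2}, L3, L4, L5), ({0, 3}, L6, L7, L8),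
     ({0, 4}, L9, L10, L11), ({1, 2}, L6, L9, L12), ({1, 3}, L3, L10, L13),
     ({1, 4}, L4, L7, L14), ({2, 3}, L0, L11, L14), ({2, 4}, L1, L8, L13),
     ({3, 4}, L2, L5, L12)]"

lemma triad_commute_check:
  "list_all (\<lambda>a. list_all (\<lambda>(b, c). (a, c) \<in> set (row b) \<and> (c, b) \<in> set (row a)) (row a)) labels"
  by (simp only: label_eval)

lemma triad_commute:
  assumes "triad a b c"
  shows "triad b a c" "triad a c b"
  using triad_commute_check mem_labels[of a] assms by (auto simp only: list_all_iff triad_def)

lemma petersen_stars:
  "\<forall>(w, x, y, z)\<in>set petersen_stars. triad x y z \<and> (\<forall>a\<in>set labels. w \<in> petersen_edge a \<longrightarrow> a = x \<or> a = y \<or> a = z)"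
  by (simp add: petersen_stars_def triad_def doubleton_eq_iff)

lemma petersen_edge_star: "w \<in> petersen_edge a \<Longrightarrow> w \<in> fst ` set petersen_stars"
  by (cases a; simp add: petersen_stars_def; elim disjE; simp)

text \<open>Only three labels occur at \<open>w\<close>, so three distinct ones are a permutation of
  the listed star, and \<open>triad\<close> is invariant under permutations.\<close>

lemma petersen_edge_triad:
  assumes "w \<in> petersen_edge a" "w \<in> petersen_edge b" "w \<in> petersen_edge c" "a \<noteq> b" "a \<noteq> c" "b \<noteq> c"
  shows "triad a b c"
proof -
  obtain x y z where xyz: "(w, x, y, z) \<in> set petersen_stars"
    using petersen_edge_star[OF assms(1)] by auto
  then have "triad x y z" "\<And>a. w \<in> petersen_edge a \<Longrightarrow> a = x \<or> a = y \<or> a = z"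
    using petersen_stars mem_labels by blast+
  from this(1) this(2)[OF assms(1)] this(2)[OF assms(2)] this(2)[OF assms(3)] assms(4-)
  show ?thesis by (blast intro: triad_commute)
qed

section \<open>The graph has no Petersen coloring\<close>

text \<open>This is all that is used of a Petersen coloring. The bijection onto a star of the
  Petersen graph supplies the common end \<open>w\<close> and the distinctness of the three
  images.\<close>

lemma petersen_coloring_labels:
  assumes "is_H_coloring petersen H \<phi>"
  obtains f :: "'a set \<Rightarrow> label" where
    "\<And>v a b c. v \<in> verts H \<Longrightarrow> {a, b, c} \<subseteq> incident H v \<Longrightarrow> distinct [a, b, c] \<Longrightarrow> triad (f a) (f b) (f c)"
proof
  define f where "f e = (SOME x. petersen_edge x = \<phi> e)" for e
  fix v a b c
  assume v: "v \<in> verts H" and abc: "{a, b, c} \<subseteq> incident H v" "distinct [a, b, c]"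
  obtain w where bij: "bij_betw \<phi> (incident H v) (incident petersen w)"
    using assms v by (auto simp: is_H_coloring_def)
  have f: "petersen_edge (f e) = \<phi> e" "w \<in> \<phi> e" if "e \<in> incident H v" for e
  proof -
    have e: "\<phi> e \<in> incident petersen w"
      using bij that by (auto simp: bij_betw_def)
    then show "w \<in> \<phi> e" by (simp add: incident_def)
    have "\<phi> e \<in> petersen_edge ` set labels"
      using e subsetD[OF edges_petersen] by (simp only: incident_def mem_Collect_eq)
    then have "\<exists>x. petersen_edge x = \<phi> e" by blast
    then show "petersen_edge (f e) = \<phi> e" unfolding f_def by (rule someI_ex)
  qed
  have "\<phi> a \<noteq> \<phi> b" "\<phi> a \<noteq> \<phi> c" "\<phi> b \<noteq> \<phi> c"
    using bij_betw_imp_inj_on[OF bij] abc by (auto dest: inj_onD)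
  then show "triad (f a) (f b) (f c)"
    using abc(1) f(1)[of a] f(1)[of b] f(1)[of c] f(2)[of a] f(2)[of b] f(2)[of c]
    by (intro petersen_edge_triad[of w]) auto
qed

text \<open>The order of the neighbors is left free, so that each use can list them as the search
  expects.\<close>

definition star :: "nat \<Rightarrow> nat \<Rightarrow> nat \<Rightarrow> nat \<Rightarrow> bool" where
  "star v a b c \<longleftrightarrow> {a, b, c} \<subseteq> set (nbrs v) \<and> distinct [a, b, c]"

locale labelled =
  fixes f :: "nat \<Rightarrow> nat \<Rightarrow> label"
  assumes commute: "f u v = f v u"
    and triad: "star v a b c \<Longrightarrow> triad (f v a) (f v b) (f v c)"
begin

text \<open>The gadget occupies the vertices \<open>s\<close> to \<open>s + 7\<close>, with
  \<open>s + i\<close> in the role of \<open>i\<close>; \<open>p\<close>, \<open>q\<close>,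
  \<open>r\<close>, \<open>t\<close> are the outer neighbors of the ports 0, 2, 3, 4. The instances
  of \<open>commute\<close> reconcile the two directions in which an inner edge is read.\<close>

lemma gadget_at:
  assumes "star s p (s + 1) (s + 5)" "star (s + 1) s (s + 2) (s + 6)" "star (s + 2) (s + 1) (s + 7) q"
    "star (s + 3) (s + 5) (s + 6) r" "star (s + 4) (s + 7) (s + 6) t" "star (s + 5) s (s + 3) (s + 7)"
    "star (s + 6) (s + 1) (s + 3) (s + 4)" "star (s + 7) (s + 2) (s + 5) (s + 4)"
  shows "(f (s + 3) r, f (s + 4) t) \<in> set (gadget_ports (f s p) (f (s + 2) q))"
  using assms[THEN triad] commute[of s "s + 1"] commute[of s "s + 5"] commute[of "s + 1" "s + 2"] commute[of "s + 1" "s + 6"]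
    commute[of "s + 2" "s + 7"] commute[of "s + 5" "s + 3"] commute[of "s + 5" "s + 7"] commute[of "s + 3" "s + 6"]
    commute[of "s + 4" "s + 7"] commute[of "s + 4" "s + 6"]
  by (intro gadget[of _ "f s (s + 1)" "f s (s + 5)" "f (s + 1) (s + 2)" "f (s + 1) (s + 6)"
    "f (s + 2) (s + 7)" _ "f (s + 5) (s + 3)" "f (s + 5) (s + 7)" "f (s + 7) (s + 4)"
    "f (s + 3) (s + 6)" _ "f (s + 6) (s + 4)"]) simp_all

text \<open>The claw has centre \<open>c\<close> and leaves \<open>a\<close>, \<open>b\<close>,
  \<open>d\<close>. The gadgets starting at \<open>s2\<close>, \<open>s3\<close>, \<open>s4\<close>,
  \<open>s1\<close> form a chain in this order, and the dangling edges leave from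
  \<open>s1 + 2\<close>, \<open>s2 + 4\<close>, \<open>s3 + 4\<close> and \<open>s4 + 4\<close> to
  \<open>o1\<close>, \<open>o2\<close>, \<open>o3\<close> and \<open>o4\<close>.\<close>

lemma block_at:
  assumes "star c a b d" "star a c (s1 + 4) (s2 + 2)" "star b c s2 s3" "star d c (s1 + 3) s4"
    and "(f (s2 + 3) (s3 + 2), f (s2 + 4) o2) \<in> set (gadget_ports (f s2 b) (f (s2 + 2) a))"
    and "(f (s3 + 3) (s4 + 2), f (s3 + 4) o3) \<in> set (gadget_ports (f s3 b) (f (s3 + 2) (s2 + 3)))"
    and "(f (s4 + 3) s1, f (s4 + 4) o4) \<in> set (gadget_ports (f s4 d) (f (s4 + 2) (s3 + 3)))"
    and "(f (s1 + 3) d, f (s1 + 4) a) \<in> set (gadget_ports (f s1 (s4 + 3)) (f (s1 + 2) o1))"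
  shows "(f (s3 + 4) o3, f (s4 + 4) o4) \<in> set (block_ports (f (s1 + 2) o1) (f (s2 + 4) o2))"
proof (rule block)
  show "triad (f c a) (f c b) (f c d)" "triad (f c b) (f b s2) (f b s3)"
    "triad (f c a) (f a (s1 + 4)) (f a (s2 + 2))" "triad (f c d) (f d (s1 + 3)) (f d s4)"
    using assms(1-4)[THEN triad] by (simp_all add: commute[of c])
  show "(f (s2 + 3) (s3 + 2), f (s2 + 4) o2) \<in> set (gadget_ports (f b s2) (f a (s2 + 2)))"
    "(f (s3 + 3) (s4 + 2), f (s3 + 4) o3) \<in> set (gadget_ports (f b s3) (f (s2 + 3) (s3 + 2)))"
    "(f (s4 + 3) s1, f (s4 + 4) o4) \<in> set (gadget_ports (f d s4) (f (s3 + 3) (s4 + 2)))"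
    "(f d (s1 + 3), f a (s1 + 4)) \<in> set (gadget_ports (f (s4 + 3) s1) (f (s1 + 2) o1))"
    using assms(5-8) by (simp_all only: commute[of s2 b] commute[of "s2 + 2" a] commute[of s3 b] commute[of "s3 + 2" "s2 + 3"]
      commute[of s4 d] commute[of "s4 + 2" "s3 + 3"] commute[of "s1 + 3" d] commute[of "s1 + 4" a] commute[of s1 "s4 + 3"])
qed

lemma no_labelling: False
proof -
  note star_eval = star_def nbrs_simps numeral_2_eq_2[symmetric]
  have G0: "(f 3 11, f 4 9) \<in> set (gadget_ports (f 0 31) (f 2 100))"
    using gadget_at[of 0 31 100 11 9] by (simp add: star_eval)
  have G12: "(f 15 22, f 16 56) \<in> set (gadget_ports (f 12 10) (f 14 9))"
    using gadget_at[of 12 10 9 22 56] by (simp add: star_eval)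
  have G20: "(f 23 30, f 24 39) \<in> set (gadget_ports (f 20 10) (f 22 15))"
    using gadget_at[of 20 10 15 30 39] by (simp add: star_eval)
  have G28: "(f 31 0, f 32 37) \<in> set (gadget_ports (f 28 11) (f 30 23))"
    using gadget_at[of 28 11 23 0 37] by (simp add: star_eval)
  have G40: "(f 43 51, f 44 49) \<in> set (gadget_ports (f 40 71) (f 42 37))"
    using gadget_at[of 40 71 37 51 49] by (simp add: star_eval)
  have G52: "(f 55 62, f 56 16) \<in> set (gadget_ports (f 52 50) (f 54 49))"
    using gadget_at[of 52 50 49 62 16] by (simp add: star_eval)
  have G60: "(f 63 70, f 64 38) \<in> set (gadget_ports (f 60 50) (f 62 55))"
    using gadget_at[of 60 50 55 70 38] by (simp add: star_eval)
  have G68: "(f 71 40, f 72 108) \<in> set (gadget_ports (f 68 51) (f 70 63))"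
    using gadget_at[of 68 51 63 40 108] by (simp add: star_eval)
  have G76: "(f 79 87, f 80 85) \<in> set (gadget_ports (f 76 107) (f 78 39))"
    using gadget_at[of 76 107 39 87 85] by (simp add: star_eval)
  have G88: "(f 91 98, f 92 38) \<in> set (gadget_ports (f 88 86) (f 90 85))"
    using gadget_at[of 88 86 85 98 38] by (simp add: star_eval)
  have G96: "(f 99 106, f 100 2) \<in> set (gadget_ports (f 96 86) (f 98 91))"
    using gadget_at[of 96 86 91 106 2] by (simp add: star_eval)
  have G104: "(f 107 76, f 108 72) \<in> set (gadget_ports (f 104 87) (f 106 99))"
    using gadget_at[of 104 87 99 76 72] by (simp add: star_eval)
  \<comment> \<open>The arguments are the centre and the leaves of the claw, the starts of the four
    gadgets, and the outer vertices in the order \<open>o2\<close>, \<open>o3\<close>,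
    \<open>o4\<close>, \<open>o1\<close>.\<close>
  have B8: "(f 24 39, f 32 37) \<in> set (block_ports (f 2 100) (f 16 56))"
    using block_at[of 8 9 10 11 0 12 20 28 56 39 37 100] G0 G12 G20 G28 by (simp add: star_eval)
  have B48: "(f 64 38, f 72 108) \<in> set (block_ports (f 42 37) (f 56 16))"
    using block_at[of 48 49 50 51 40 52 60 68 16 38 108 37] G40 G52 G60 G68 by (simp add: star_eval)
  have B84: "(f 100 2, f 108 72) \<in> set (block_ports (f 78 39) (f 92 38))"
    using block_at[of 84 85 86 87 76 88 96 104 38 2 72 39] G76 G88 G96 G104 by (simp add: star_eval)
  show False
  proof (rule centre)
    show "triad (f 36 37) (f 36 38) (f 36 39)" "triad (f 36 37) (f 37 32) (f 37 42)"
      "triad (f 36 39) (f 39 24) (f 39 78)" "triad (f 36 38) (f 38 64) (f 38 92)"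
      using triad[of 36 37 38 39] triad[of 37 36 32 42] triad[of 39 36 24 78] triad[of 38 36 64 92]
      by (simp_all add: star_eval commute[of 36])
    \<comment> \<open>In this block the edges towards the fourth claw are the outputs, so the
      relation has to be reversed.\<close>
    show "(f 2 100, f 16 56) \<in> set (block_ports (f 39 24) (f 37 32))"
      using block_ports_sym[OF B8] by (simp add: commute[of 39] commute[of 37])
    show "(f 38 64, f 72 108) \<in> set (block_ports (f 37 42) (f 16 56))"
      using B48 by (simp add: commute[of 38] commute[of 37] commute[of 16])
    show "(f 2 100, f 72 108) \<in> set (block_ports (f 39 78) (f 38 92))"
      using B84 by (simp add: commute[of 2] commute[of 72] commute[of 39] commute[of 38])
  qed
qed

end

lemma no_petersen_coloring_explicit_graph: "\<not> has_petersen_coloring explicit_graph"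
proof
  assume "has_petersen_coloring explicit_graph"
  then obtain \<phi> where "is_H_coloring petersen explicit_graph \<phi>"
    by (auto simp: has_petersen_coloring_def)
  then obtain f :: "nat set \<Rightarrow> label" where f: "\<And>v a b c. v \<in> verts explicit_graph \<Longrightarrow> {a, b, c} \<subseteq> incident explicit_graph v \<Longrightarrow>
      distinct [a, b, c] \<Longrightarrow> triad (f a) (f b) (f c)"
    by (rule petersen_coloring_labels) blast
  interpret labelled "\<lambda>u v. f {u, v}"
  proof
    show "f {u, v} = f {v, u}" for u v by (simp add: insert_commute)
    show "triad (f {v, a}) (f {v, b}) (f {v, c})" if "star v a b c" for v a b c
    proof (rule f[of v])
      show "v \<in> verts explicit_graph"
        using that nbrs_less[of a v] by (auto simp: star_def)
      show "{{v, a}, {v, b}, {v, c}} \<subseteq> incident explicit_graph v"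
        using that by (auto simp: incident_explicit_graph star_def)
      show "distinct [{v, a}, {v, b}, {v, c}]"
        using that by (auto simp: star_def doubleton_eq_iff)
    qed
  qed
  show False by (rule no_labelling)
qed

lemma no_normal_coloring_explicit_graph: "\<not> has_normal_5_edge_coloring explicit_graph"
  using normal_5_edge_coloring_imp_petersen_coloring[OF simple_explicit_graph cubic_explicit_graph] no_petersen_coloring_explicit_graph
  by (auto simp: has_normal_5_edge_coloring_def)

theorem theorem1p1:
  shows "\<exists>G :: nat graph.
    simple_graph G \<and> connected_graph G \<and> bridgeless G \<and> cubic G \<and>
    verts G = {0..111} \<and> card (verts G) = 112 \<and> card (edges G) = 168 \<and>
    \<not> has_petersen_coloring G \<and> \<not> has_normal_5_edge_coloring G \<and>
    girth G = 5 \<and> edge_connectivity G = 3 \<and> vertex_connectivity G = 3 \<and>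
    edges G = explicit_edges \<and>
    edge_list_digest G = ''dc16cc18600cf77c8661b7baf89c7019f265299308541961ff884ea7187b4e8b''"
proof (intro exI[of _ explicit_graph] conjI)
  show "card (edges explicit_graph) = 168"
    by (simp add: card_explicit_edges)
  show "edge_list_digest explicit_graph = ''dc16cc18600cf77c8661b7baf89c7019f265299308541961ff884ea7187b4e8b''"
    unfolding edge_list_digest_def normalized_edge_list_def sorted_edge_pairs_explicit_graph
      edge_list_text sha256_edge_list_text ..
qed (simp_all add: simple_explicit_graph connected_explicit_graph bridgeless_explicit_graph
    cubic_explicit_graph girth_explicit_graph edge_connectivity_explicit_graph
    vertex_connectivity_explicit_graph no_petersen_coloring_explicit_graph
    no_normal_coloring_explicit_graph)

end
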